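(* Let $d_k$, $k=0,1,2$, be the optimal weights, and let $\omega_k$, $k=0,1,2$, be the nonlinear weights, at the cell boundary $x_{j+1/2}$, both as defined in the context. Assume that the parameter $\epsilon=\epsilon(\Delta x)$ in the definition of the unnormalized weights $$\alpha_k=d_k\Big(1+\frac{\tau_5^2}{\beta_k^2+\epsilon}\Big)$$ is chosen as $\epsilon=\Delta x^\gamma$ with $0<\gamma\le4$. If $f$ is smooth around the global stencil $\{x_{j-2},x_{j-1},x_j,x_{j+1},x_{j+2}\}$, then for $k=0,1,2$ $$|\omega_k-d_k|=\mathcal O(\Delta x^4)\qquad(\Delta x\to0),$$ even near critical points of $f$ (i.e. regardless of whether derivatives of $f$ vanish at or near $x_{j+1/2}$).
   Context: Grid: uniform cells $[x_{i-1/2},x_{i+1/2}]$ with centers $x_i$, size $\Delta x$; $f_i:=f(x_i)$. Nonlinear weights. For $k=0,1,2$ define $D_{1,k}f=(1-k)f_{j-2+k}+(2k-3)f_{j-1+k}+(2-k)f_{j+k}$ and $D_{2,k}f=f_{j-2+k}-2f_{j-1+k}+f_{j+k}$. The local smoothness indicators are $\beta_k=\theta|D_{1,k}f|+|D_{2,k}f|$ with a fixed $\theta\in(0,1]$, and the global one is $\tau_5=f_{j-2}-4f_{j-1}+6f_j-4f_{j+1}+f_{j+2}$. Then $\alpha_k=d_k\big(1+\tau_5^2/(\beta_k^2+\epsilon)\big)$ and $\omega_k=\alpha_k/(\alpha_0+\alpha_1+\alpha_2)$. Optimal weights. Let $\varphi_0,\dots,\varphi_5$ be exponential polynomials whose derivatives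 span the five-dimensional space used on the stencil $\{x_{j-2},\dots,x_{j+2}\}$: the span of $\{1,x,x^2,\sinh\lambda x,\cosh\lambda x\}$ or of $\{1,x,x^2,\sinh\lambda x,\cosh\lambda x+\lambda^6x^5/5!\}$, with tension parameter $\lambda\in\mathbb R\cup i\mathbb R$, $\lambda\neq0$ (or $\{1,x,\dots,x^4\}$). Let $L_0,\dots,L_5$ be the Lagrange functions determined by $\sum_{n=0}^5L_n(x)\varphi_\ell(x_{j-5/2+n}-x_{j+1/2})=\varphi_\ell(x-x_{j+1/2})$, $\ell=0,\dots,5$. With $h$ the flux function having cell averages $\bar h_i$ and $H$ its primitive, the numerical flux $\hat f_{j+1/2}=\sum_{n=0}^5L_n'(x_{j+1/2})H(x_{j-5/2+n})$ equals $\sum_{\ell=0}^4C_\ell\,\bar h_{j-2+\ell}$ with $C_\ell=\Delta x\sum_{n=\ell+1}^{5}L_n'(x_{j+1/2})$. For $k=0,1,2$ the local flux is $\hat f^k_{j+1/2}=\sum_{\ell=0}^2C^k_\ell\,\bar h_{j-2+k+\ell}$ with $C^k_\ell=\Delta x\sum_{n=\ell+1}^{3}(u_n^{k})'(x_{j+1/2})$, where $u^k_0,\dots,u^k_3$ are the cubic Lagrange polynomials on the cell boundaries $x_{j-5/2+k},\dots,x_{j+1/2+k}$. The optimal weights are those for which $\hat f_{j+1/2}=\sum_{k=0}^2d_k\hat f^k_{j+1/2}$, given by $$d_0=C_0/C^0_0,\qquad d_1=(C_1-d_0C^0_1)/C^1_0,\qquad d_2=1-d_0-d_1.$$ They may depend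 on $\lambda$ and tend to the classical ideal weights $(0.1,0.6,0.3)$ as $\Delta x\to0$. *)

theory Defs
  imports "HOL-Analysis.Analysis" "HOL-Library.Landau_Symbols"
begin

section \<open>Grid\<close>

text \<open>A uniform grid of mesh size \<open>h\<close> (the \<open>\<Delta>x\<close> of the literature) and offset \<open>a\<close>.
  Half-integer indices are rounded down to integers: \<open>bdry a h i\<close> is \<open>x\<^bsub>i+1/2\<^esub>\<close>, hence
  \<open>x\<^bsub>j-5/2+n\<^esub>\<close> is \<open>bdry a h (j - 3 + n)\<close>.\<close>

definition center :: "real \<Rightarrow> real \<Rightarrow> int \<Rightarrow> real" where
  "center a h i = a + of_int i * h"

definition bdry :: "real \<Rightarrow> real \<Rightarrow> int \<Rightarrow> real" where
  "bdry a h i = a + (of_int i + 1/2) * h"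

definition smooth_near :: "(real \<Rightarrow> real) \<Rightarrow> real \<Rightarrow> bool" where
  "smooth_near f x0 \<longleftrightarrow>
     (\<exists>S. open S \<and> x0 \<in> S \<and> (\<forall>n. \<forall>x\<in>S. (deriv ^^ n) f field_differentiable (at x)))"

section \<open>Exponential polynomials\<close>

text \<open>Since the tension parameter may be imaginary, functions are complex-valued and spans are
  over the complex numbers; for imaginary \<open>lam\<close> the hyperbolic functions are then trigonometric
  functions up to a constant factor.\<close>

definition lin_span :: "nat \<Rightarrow> (nat \<Rightarrow> real \<Rightarrow> complex) \<Rightarrow> (real \<Rightarrow> complex) set" where
  "lin_span m b = {g. \<exists>c. g = (\<lambda>x. \<Sum>i<m. c i * b i x)}"

definition lin_indep :: "nat \<Rightarrow> (nat \<Rightarrow> real \<Rightarrow> complex) \<Rightarrow> bool" where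
  "lin_indep m b \<longleftrightarrow> (\<forall>c. (\<forall>x. (\<Sum>i<m. c i * b i x) = 0) \<longrightarrow> (\<forall>i<m. c i = 0))"

definition basis_poly :: "nat \<Rightarrow> real \<Rightarrow> complex" where
  "basis_poly i x = of_real x ^ i"

definition basis_hyp :: "complex \<Rightarrow> nat \<Rightarrow> real \<Rightarrow> complex" where
  "basis_hyp lam i x =
     [1, of_real x, of_real x ^ 2, sinh (lam * of_real x), cosh (lam * of_real x)] ! i"

definition basis_hyp_corr :: "complex \<Rightarrow> nat \<Rightarrow> real \<Rightarrow> complex" where
  "basis_hyp_corr lam i x =
     [1, of_real x, of_real x ^ 2, sinh (lam * of_real x),
      cosh (lam * of_real x) + lam ^ 6 * of_real x ^ 5 / fact 5] ! i"

text \<open>Six functions \<open>\<phi> 0, \<dots>, \<phi> 5\<close> whose derivatives span the space of the five functions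
  \<open>b 0, \<dots>, b 4\<close>. Linear independence is needed for the Lagrange functions to be determined: for
  instance \<open>x, x\<^sup>2, x\<^sup>3, x\<^sup>4, x\<^sup>5, x\<^sup>5\<close> satisfies the other two conditions for \<open>basis_poly\<close>.\<close>

definition interp_system ::
  "(nat \<Rightarrow> real \<Rightarrow> complex) \<Rightarrow> (nat \<Rightarrow> real \<Rightarrow> complex) \<Rightarrow> bool" where
  "interp_system b \<phi> \<longleftrightarrow>
     (\<forall>l<6. \<forall>x. \<phi> l differentiable (at x)) \<and>
     lin_span 6 (\<lambda>l x. vector_derivative (\<phi> l) (at x)) = lin_span 5 b \<and>
     lin_indep 6 \<phi>"

section \<open>Optimal weights\<close>

text \<open>The (real-valued) Lagrange functions on \<open>x\<^bsub>j-5/2\<^esub>, \<dots>, x\<^bsub>j+5/2\<^esub>\<close>; the condition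
  \<open>extensional\<close> only fixes the irrelevant values at indices above 5. They are uniquely determined
  for all sufficiently small \<open>h > 0\<close>.\<close>

definition lagrange_exp ::
  "(nat \<Rightarrow> real \<Rightarrow> complex) \<Rightarrow> real \<Rightarrow> real \<Rightarrow> int \<Rightarrow> nat \<Rightarrow> real \<Rightarrow> real" where
  "lagrange_exp \<phi> a h j = (THE L. L \<in> extensional {0..5} \<and>
     (\<forall>l\<le>5. \<forall>x. (\<Sum>n=0..5. of_real (L n x) * \<phi> l (bdry a h (j - 3 + int n) - bdry a h j))
                 = \<phi> l (x - bdry a h j)))"

text \<open>The coefficients \<open>C\<^sub>l\<close> of the numerical flux
  \<open>\<Sum>n=0..5. L\<^sub>n'(x\<^bsub>j+1/2\<^esub>) H(x\<^bsub>j-5/2+n\<^esub>)\<close> with respect to the cell averages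
  \<open>(H(x\<^bsub>i+1/2\<^esub>) - H(x\<^bsub>i-1/2\<^esub>)) / h\<close>, and \<open>C\<^sup>k\<^sub>l\<close> of the local fluxes.\<close>

definition C_glob ::
  "(nat \<Rightarrow> real \<Rightarrow> complex) \<Rightarrow> real \<Rightarrow> real \<Rightarrow> int \<Rightarrow> nat \<Rightarrow> real" where
  "C_glob \<phi> a h j l = h * (\<Sum>n=l+1..5. deriv (lagrange_exp \<phi> a h j n) (bdry a h j))"

definition lagrange_cubic :: "real \<Rightarrow> real \<Rightarrow> int \<Rightarrow> nat \<Rightarrow> nat \<Rightarrow> real \<Rightarrow> real" where
  "lagrange_cubic a h j k n x =
     (\<Prod>m\<in>{0..3} - {n}. (x - bdry a h (j - 3 + int k + int m)) /
        (bdry a h (j - 3 + int k + int n) - bdry a h (j - 3 + int k + int m)))"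

definition C_loc :: "real \<Rightarrow> real \<Rightarrow> int \<Rightarrow> nat \<Rightarrow> nat \<Rightarrow> real" where
  "C_loc a h j k l = h * (\<Sum>n=l+1..3. deriv (lagrange_cubic a h j k n) (bdry a h j))"

definition optimal_weight ::
  "(nat \<Rightarrow> real \<Rightarrow> complex) \<Rightarrow> real \<Rightarrow> real \<Rightarrow> int \<Rightarrow> nat \<Rightarrow> real" where
  "optimal_weight \<phi> a h j k =
    (let d0 = C_glob \<phi> a h j 0 / C_loc a h j 0 0;
         d1 = (C_glob \<phi> a h j 1 - d0 * C_loc a h j 0 1) / C_loc a h j 1 0
     in [d0, d1, 1 - d0 - d1] ! k)"

section \<open>Nonlinear weights\<close>

text \<open>Here \<open>v i\<close> is the grid value \<open>f(x\<^sub>i)\<close> and \<open>d\<close> is the triple of optimal weights.\<close>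

definition D1 :: "(int \<Rightarrow> real) \<Rightarrow> int \<Rightarrow> nat \<Rightarrow> real" where
  "D1 v j k = (1 - real k) * v (j - 2 + int k) + (2 * real k - 3) * v (j - 1 + int k)
     + (2 - real k) * v (j + int k)"

definition D2 :: "(int \<Rightarrow> real) \<Rightarrow> int \<Rightarrow> nat \<Rightarrow> real" where
  "D2 v j k = v (j - 2 + int k) - 2 * v (j - 1 + int k) + v (j + int k)"

definition beta :: "real \<Rightarrow> (int \<Rightarrow> real) \<Rightarrow> int \<Rightarrow> nat \<Rightarrow> real" where
  "beta \<theta> v j k = \<theta> * \<bar>D1 v j k\<bar> + \<bar>D2 v j k\<bar>"

definition tau5 :: "(int \<Rightarrow> real) \<Rightarrow> int \<Rightarrow> real" where
  "tau5 v j = v (j - 2) - 4 * v (j - 1) + 6 * v j - 4 * v (j + 1) + v (j + 2)"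

definition alpha ::
  "(nat \<Rightarrow> real) \<Rightarrow> real \<Rightarrow> real \<Rightarrow> (int \<Rightarrow> real) \<Rightarrow> int \<Rightarrow> nat \<Rightarrow> real" where
  "alpha d \<theta> \<epsilon> v j k = d k * (1 + (tau5 v j)\<^sup>2 / ((beta \<theta> v j k)\<^sup>2 + \<epsilon>))"

definition omega ::
  "(nat \<Rightarrow> real) \<Rightarrow> real \<Rightarrow> real \<Rightarrow> (int \<Rightarrow> real) \<Rightarrow> int \<Rightarrow> nat \<Rightarrow> real" where
  "omega d \<theta> \<epsilon> v j k = alpha d \<theta> \<epsilon> v j k / (\<Sum>i=0..2. alpha d \<theta> \<epsilon> v j i)"

end

theory Submission
  imports Defs
begin

text \<open>
  Since the \<open>d i\<close> sum to \<open>1\<close>, writing \<open>q i = \<tau>\<^sup>2 / (\<beta> i\<^sup>2 + \<epsilon>)\<close> and \<open>S = \<Sum>i. d i * q i\<close> gives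
  \<open>\<omega> k - d k = d k * (q k - S) / (1 + S)\<close>. A smooth \<open>f\<close> has fourth difference \<open>\<tau> = O(h^4)\<close>, and
  \<open>\<epsilon> \<ge> h^4\<close>, so \<open>q i \<le> \<tau>\<^sup>2 / h^4 = O(h^4)\<close> whatever the smoothness indicators are. Everything
  therefore reduces to the boundedness of the optimal weights.

  The interpolation space is spanned by \<open>1, x, x\<^sup>2, x\<^sup>3\<close> and two real functions \<open>p\<close>, \<open>q\<close> asymptotic to
  \<open>x^4\<close>, \<open>x^5\<close> at the origin. On the rescaled nodes \<open>-3, \<dots>, 2\<close>, exactness on cubics leaves a
  two-by-two system for the Lagrange functions, whose determinant tends to its value \<open>2880\<close> for
  \<open>x^4, x^5\<close>. Hence the Lagrange functions exist and are unique for small \<open>h\<close>, and the rescaled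
  slopes \<open>h * L n'(x\<^bsub>j+1/2\<^esub>)\<close> converge.
\<close>

section \<open>Spans of exponential polynomials\<close>

lemma lin_spanI: "f = (\<lambda>x. \<Sum>i<m. c i * b i x) \<Longrightarrow> f \<in> lin_span m b"
  by (auto simp: lin_span_def)

lemma lin_span_subset_iff: "lin_span m g \<subseteq> lin_span n b \<longleftrightarrow> (\<forall>i<m. g i \<in> lin_span n b)"
proof
  assume sub: "lin_span m g \<subseteq> lin_span n b"
  show "\<forall>i<m. g i \<in> lin_span n b"
  proof (intro allI impI)
    fix i assume "i < m"
    then have "g i = (\<lambda>x. \<Sum>i'<m. (if i' = i then 1 else 0) * g i' x)"
      by (auto simp: if_distrib [of "\<lambda>c. c * _"] cong: if_cong)
    then have "g i \<in> lin_span m g"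
      unfolding lin_span_def by (intro CollectI exI [of _ "\<lambda>i'. if i' = i then 1 else 0"])
    then show "g i \<in> lin_span n b"
      using sub by blast
  qed
next
  assume "\<forall>i<m. g i \<in> lin_span n b"
  then have "\<exists>c. \<forall>i<m. g i = (\<lambda>x. \<Sum>k<n. c i k * b k x)"
    by (intro choice) (auto simp: lin_span_def)
  then obtain c where c: "\<And>i. i < m \<Longrightarrow> g i = (\<lambda>x. \<Sum>k<n. c i k * b k x)"
    by blast
  show "lin_span m g \<subseteq> lin_span n b"
  proof
    fix f assume "f \<in> lin_span m g"
    then obtain d where d: "f = (\<lambda>x. \<Sum>i<m. d i * g i x)"
      by (auto simp: lin_span_def)
    have "f = (\<lambda>x. \<Sum>k<n. (\<Sum>i<m. d i * c i k) * b k x)"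
    proof
      fix x
      have "f x = (\<Sum>i<m. \<Sum>k<n. d i * c i k * b k x)"
        by (simp add: d c sum_distrib_left mult.assoc)
      also have "\<dots> = (\<Sum>k<n. \<Sum>i<m. d i * c i k * b k x)"
        by (rule sum.swap)
      finally show "f x = (\<Sum>k<n. (\<Sum>i<m. d i * c i k) * b k x)"
        by (simp add: sum_distrib_right)
    qed
    then show "f \<in> lin_span n b"
      by (rule lin_spanI)
  qed
qed

lemma lin_span_base: "i < m \<Longrightarrow> b i \<in> lin_span m b"
  using lin_span_subset_iff [of m b m b] by simp

lemma lin_span_scale: "g \<in> lin_span m b \<Longrightarrow> (\<lambda>x. r * g x) \<in> lin_span m b"
proof -
  assume "g \<in> lin_span m b"
  then obtain c where "g = (\<lambda>x. \<Sum>i<m. c i * b i x)"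
    by (auto simp: lin_span_def)
  then have "(\<lambda>x. r * g x) = (\<lambda>x. \<Sum>i<m. (r * c i) * b i x)"
    by (simp add: sum_distrib_left mult.assoc)
  then show ?thesis
    by (rule lin_spanI)
qed

lemma lin_span_add:
  assumes "f \<in> lin_span m b" "g \<in> lin_span m b"
  shows "(\<lambda>x. f x + g x) \<in> lin_span m b"
proof -
  obtain c d where "f = (\<lambda>x. \<Sum>i<m. c i * b i x)" "g = (\<lambda>x. \<Sum>i<m. d i * b i x)"
    using assms by (auto simp: lin_span_def)
  then have "(\<lambda>x. f x + g x) = (\<lambda>x. \<Sum>i<m. (c i + d i) * b i x)"
    by (simp add: sum.distrib algebra_simps)
  then show ?thesis
    by (rule lin_spanI)
qed

lemma lin_span_cong:
  assumes "\<And>i. i < m \<Longrightarrow> b i = b' i"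
  shows "lin_span m b = lin_span m b'"
  using assms by (simp add: lin_span_def)

text \<open>The condition is linear in the reproduced function, so it depends only on the span. This
  allows the Lagrange conditions to be moved from \<open>\<phi>\<close> to a more convenient
  basis.\<close>

lemma reproduces_lin_span_iff:
  "(\<forall>i<m. (\<Sum>n\<in>N. u n * b i (z n)) = b i y) \<longleftrightarrow>
   (\<forall>g\<in>lin_span m b. (\<Sum>n\<in>N. u n * g (z n)) = g y)"
proof
  assume *: "\<forall>i<m. (\<Sum>n\<in>N. u n * b i (z n)) = b i y"
  show "\<forall>g\<in>lin_span m b. (\<Sum>n\<in>N. u n * g (z n)) = g y"
  proof
    fix g assume "g \<in> lin_span m b"
    then obtain c where c: "g = (\<lambda>x. \<Sum>i<m. c i * b i x)"
      by (auto simp: lin_span_def)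
    have "(\<Sum>n\<in>N. u n * g (z n)) = (\<Sum>n\<in>N. \<Sum>i<m. c i * (u n * b i (z n)))"
      by (simp add: c sum_distrib_left mult.left_commute)
    also have "\<dots> = (\<Sum>i<m. \<Sum>n\<in>N. c i * (u n * b i (z n)))"
      by (rule sum.swap)
    also have "\<dots> = g y"
      using * by (simp add: c flip: sum_distrib_left)
    finally show "(\<Sum>n\<in>N. u n * g (z n)) = g y" .
  qed
qed (auto intro: lin_span_base)

text \<open>Gaussian elimination by induction on the set of equations.\<close>

lemma underdetermined_system_solvable:
  fixes A :: "'i \<Rightarrow> 'j \<Rightarrow> 'a::field"
  assumes "finite I" "finite J" "card I < card J"
  shows "\<exists>c. (\<exists>l\<in>J. c l \<noteq> 0) \<and> (\<forall>i\<in>I. (\<Sum>l\<in>J. A i l * c l) = 0)"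
  using assms
proof (induction I arbitrary: J A rule: finite_induct)
  case empty
  then have "J \<noteq> {}"
    by auto
  then show ?case
    by (intro exI [of _ "\<lambda>_. 1"]) auto
next
  case (insert i I)
  show ?case
  proof (cases "\<forall>l\<in>J. A i l = 0")
    case True
    then show ?thesis
      using insert.IH [of J A] insert.hyps insert.prems by auto
  next
    case False
    then obtain p where p: "p \<in> J" "A i p \<noteq> 0"
      by blast
    define J' where "J' = J - {p}"
    \<comment> \<open>Subtracting a multiple of row \<open>i\<close> eliminates the pivot unknown
      \<open>p\<close> from the other rows; \<open>d\<close> below recovers it by
      back-substitution.\<close>
    define A' where "A' r l = A r l - A r p * A i l / A i p" for r l
    have "card I < card J'"
      using insert.hyps insert.prems p by (simp add: J'_def)
    then obtain c where c: "\<exists>l\<in>J'. c l \<noteq> 0" "\<And>r. r \<in> I \<Longrightarrow> (\<Sum>l\<in>J'. A' r l * c l) = 0"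
      using insert.IH [of J' A'] insert.prems by (auto simp: J'_def)
    define s where "s = (\<Sum>l\<in>J'. A i l * c l)"
    define d where "d l = (if l = p then - s / A i p else c l)" for l
    have split: "(\<Sum>l\<in>J. A r l * d l) = - A r p * s / A i p + (\<Sum>l\<in>J'. A r l * c l)" for r
    proof -
      have "(\<Sum>l\<in>J'. A r l * d l) = (\<Sum>l\<in>J'. A r l * c l)"
        by (intro sum.cong) (auto simp: d_def J'_def)
      then show ?thesis
        using p insert.prems by (simp add: sum.remove [of J p] d_def flip: J'_def)
    qed
    have "(\<Sum>l\<in>J. A r l * d l) = 0" if "r \<in> I" for r
    proof -
      have "0 = (\<Sum>l\<in>J'. A r l * c l - A r p / A i p * (A i l * c l))"
        using c(2) [OF that] by (simp add: A'_def algebra_simps)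
      also have "\<dots> = (\<Sum>l\<in>J'. A r l * c l) - A r p / A i p * s"
        by (simp add: sum_subtractf s_def sum_distrib_left)
      finally show ?thesis
        by (simp add: split)
    qed
    moreover have "(\<Sum>l\<in>J. A i l * d l) = 0"
      using p by (simp add: split flip: s_def)
    moreover have "\<exists>l\<in>J. d l \<noteq> 0"
      using c(1) by (auto simp: d_def J'_def)
    ultimately show ?thesis
      by (intro exI [of _ d]) auto
  qed
qed

section \<open>Recovering spans from their derivatives\<close>

lemma has_vector_derivative_lin_comb:
  fixes b b' :: "nat \<Rightarrow> real \<Rightarrow> complex"
  assumes "\<And>i x. i < m \<Longrightarrow> (b i has_vector_derivative b' i x) (at x)"
  shows "((\<lambda>x. \<Sum>i<m. c i * b i x) has_vector_derivative (\<Sum>i<m. c i * b' i x)) (at x)"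
  using assms by (intro has_vector_derivative_sum has_vector_derivative_mult_right) auto

lemma vector_derivatives_eq_imp_diff_const:
  fixes f g :: "real \<Rightarrow> complex"
  assumes "\<And>x. (f has_vector_derivative d x) (at x)" "\<And>x. (g has_vector_derivative d x) (at x)"
  obtains c where "f = (\<lambda>x. g x + c * 1)"
proof -
  have "((\<lambda>x. f x - g x) has_vector_derivative 0) (at x within UNIV)" for x
    using has_vector_derivative_diff [OF assms(1) assms(2)] by simp
  then obtain c where "\<And>x. f x - g x = c"
    using has_vector_derivative_zero_constant [of UNIV "\<lambda>x. f x - g x"] by auto
  then show ?thesis
    by (intro that [of c]) (auto simp: algebra_simps)
qed

text \<open>Integrating a combination of the \<open>g'\<close> gives the same combination of the
  \<open>g\<close> up to a constant, which the span absorbs.\<close>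

lemma lin_span_subset_of_derivatives:
  assumes f: "\<And>i x. i < m \<Longrightarrow> (f i has_vector_derivative f' i x) (at x)"
    and g: "\<And>i x. i < n \<Longrightarrow> (g i has_vector_derivative g' i x) (at x)"
    and sub: "lin_span m f' \<subseteq> lin_span n g'"
    and const: "(\<lambda>_. 1) \<in> lin_span n g"
  shows "lin_span m f \<subseteq> lin_span n g"
  unfolding lin_span_subset_iff
proof (intro allI impI)
  fix i assume i: "i < m"
  then obtain c where c: "f' i = (\<lambda>x. \<Sum>k<n. c k * g' k x)"
    using sub by (auto simp: lin_span_subset_iff) (auto simp: lin_span_def)
  obtain r where "f i = (\<lambda>x. (\<Sum>k<n. c k * g k x) + r * 1)"
    by (rule vector_derivatives_eq_imp_diff_const [of "f i" "f' i" "\<lambda>x. \<Sum>k<n. c k * g k x"])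
      (auto simp: c i g intro!: f [OF i, unfolded c] has_vector_derivative_lin_comb)
  moreover have "(\<lambda>x. \<Sum>k<n. c k * g k x) \<in> lin_span n g"
    by (auto simp: lin_span_def)
  ultimately show "f i \<in> lin_span n g"
    using lin_span_add lin_span_scale [OF const] by simp
qed

text \<open>The six derivatives live in the span of five functions, so some nontrivial combination of the
  \<open>\<phi> l\<close> has derivative zero; by independence it is a nonzero constant.\<close>

lemma interp_system_one_in_span:
  assumes "interp_system b \<phi>"
  shows "(\<lambda>_. 1) \<in> lin_span 6 \<phi>"
proof -
  define \<phi>' where "\<phi>' l x = vector_derivative (\<phi> l) (at x)" for l x
  have der: "(\<phi> l has_vector_derivative \<phi>' l x) (at x)" if "l < 6" for l x
    using assms that by (auto simp: interp_system_def \<phi>'_def vector_derivative_works)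
  have "lin_span 6 \<phi>' = lin_span 5 b"
    using assms unfolding interp_system_def \<phi>'_def by blast
  then have "\<forall>l<6. \<phi>' l \<in> lin_span 5 b"
    using lin_span_subset_iff [of 6 \<phi>' 5 b] by simp
  then have "\<exists>A. \<forall>l<6. \<phi>' l = (\<lambda>x. \<Sum>i<5. A l i * b i x)"
    by (intro choice) (auto simp: lin_span_def)
  then obtain A where A: "\<And>l. l < 6 \<Longrightarrow> \<phi>' l = (\<lambda>x. \<Sum>i<5. A l i * b i x)"
    by blast
  obtain c where c: "\<exists>l<6. c l \<noteq> 0" "\<And>i. i < 5 \<Longrightarrow> (\<Sum>l<6. A l i * c l) = 0"
    using underdetermined_system_solvable [of "{..<5::nat}" "{..<6::nat}" "\<lambda>i l. A l i"] by auto
  have "(\<Sum>l<6. c l * \<phi>' l x) = 0" for x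
  proof -
    have "(\<Sum>l<6. c l * \<phi>' l x) = (\<Sum>l<6. \<Sum>i<5. A l i * c l * b i x)"
      by (simp add: A sum_distrib_left mult_ac)
    also have "\<dots> = (\<Sum>i<5. \<Sum>l<6. A l i * c l * b i x)"
      by (rule sum.swap)
    also have "\<dots> = 0"
      by (simp add: c(2) flip: sum_distrib_right)
    finally show ?thesis .
  qed
  then have "((\<lambda>x. \<Sum>l<6. c l * \<phi> l x) has_vector_derivative 0) (at x)" for x
    using has_vector_derivative_lin_comb [of 6 \<phi> \<phi>' c x, OF der] by simp
  then obtain r where r: "(\<lambda>x. \<Sum>l<6. c l * \<phi> l x) = (\<lambda>x. 0 + r * 1)"
    using vector_derivatives_eq_imp_diff_const [where d = "\<lambda>_. 0" and g = "\<lambda>_. 0", OF _ has_vector_derivative_const]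
    by blast
  have "r \<noteq> 0"
  proof
    assume "r = 0"
    then have "\<forall>x. (\<Sum>l<6. c l * \<phi> l x) = 0"
      using r by (simp add: fun_eq_iff)
    then have "\<forall>l<6. c l = 0"
      using assms unfolding interp_system_def lin_indep_def by blast
    then show False
      using c(1) by blast
  qed
  then have "(\<lambda>_. 1) = (\<lambda>x. inverse r * (\<Sum>l<6. c l * \<phi> l x))"
    using r by (auto simp: fun_eq_iff)
  moreover have "(\<lambda>x. \<Sum>l<6. c l * \<phi> l x) \<in> lin_span 6 \<phi>"
    by (auto simp: lin_span_def)
  ultimately show ?thesis
    using lin_span_scale by metis
qed

text \<open>Both spans contain the constants and have the same space of derivatives, so integration
  gives inclusion in both directions.\<close>

lemma interp_system_span_eq:
  assumes phi: "interp_system b \<phi>"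
    and E: "\<And>i x. i < 6 \<Longrightarrow> (E i has_vector_derivative E' i x) (at x)"
    and E': "lin_span 6 E' = lin_span 5 b"
    and one: "(\<lambda>_. 1) \<in> lin_span 6 E"
  shows "lin_span 6 \<phi> = lin_span 6 E"
proof -
  have der: "(\<phi> l has_vector_derivative vector_derivative (\<phi> l) (at x)) (at x)" if "l < 6" for l x
    using phi that by (auto simp: interp_system_def vector_derivative_works)
  have eq: "lin_span 6 (\<lambda>l x. vector_derivative (\<phi> l) (at x)) = lin_span 6 E'"
    using phi E' by (simp add: interp_system_def)
  show ?thesis
  proof
    show "lin_span 6 \<phi> \<subseteq> lin_span 6 E"
      by (rule lin_span_subset_of_derivatives [OF der E _ one]) (use eq in auto)
    show "lin_span 6 E \<subseteq> lin_span 6 \<phi>"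
      by (rule lin_span_subset_of_derivatives [OF E der _ interp_system_one_in_span [OF phi]])
        (use eq in auto)
  qed
qed

section \<open>Leading terms of cosh and sinh at the origin\<close>

lemma exp_remainder_limit:
  "((\<lambda>z::complex. (exp z - (\<Sum>i\<le>5. z ^ i / fact i)) / z ^ 5) \<longlongrightarrow> 0) (at 0)"
proof (rule Lim_null_comparison)
  show "\<forall>\<^sub>F z in at 0. norm ((exp z - (\<Sum>i\<le>5. z ^ i / fact i)) / z ^ 5) \<le> exp \<bar>Re z\<bar> * norm (z::complex)"
  proof (intro always_eventually allI)
    fix z :: complex
    \<comment> \<open>The Taylor remainder is of order 6, one more than the divisor
      \<open>z ^ 5\<close>.\<close>
    have "norm (exp z - (\<Sum>i\<le>5. z ^ i / fact i)) \<le> exp \<bar>Re z\<bar> * norm z ^ 6 / fact 5"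
      using Taylor_exp [of z 5] by simp
    also have "\<dots> \<le> exp \<bar>Re z\<bar> * norm z ^ 6 / 1"
      by (intro divide_left_mono) (auto simp: fact_numeral)
    finally have "norm (exp z - (\<Sum>i\<le>5. z ^ i / fact i)) \<le> (exp \<bar>Re z\<bar> * norm z) * norm z ^ 5"
      by (simp add: eval_nat_numeral mult_ac)
    then show "norm ((exp z - (\<Sum>i\<le>5. z ^ i / fact i)) / z ^ 5) \<le> exp \<bar>Re z\<bar> * norm z"
      by (cases "z = 0") (auto simp: norm_divide norm_power pos_divide_le_eq)
  qed
  show "((\<lambda>z::complex. exp \<bar>Re z\<bar> * norm z) \<longlongrightarrow> 0) (at 0)"
    by (auto intro!: tendsto_eq_intros)
qed

lemma exp_remainder_limit_minus:
  "((\<lambda>z::complex. (exp (- z) - (\<Sum>i\<le>5. (- z) ^ i / fact i)) / z ^ 5) \<longlongrightarrow> 0) (at 0)"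
proof -
  have "filterlim (\<lambda>z::complex. - z) (at 0) (at 0)"
    by (auto simp: filterlim_at eventually_at_filter intro!: tendsto_eq_intros)
  from tendsto_minus [OF filterlim_compose [OF exp_remainder_limit this]] show ?thesis
    by simp
qed

text \<open>Averaging the exponential remainders at \<open>z\<close> and \<open>- z\<close> isolates
  the even part, whose first surviving term is \<open>z ^ 4 / 24\<close>. The remainders are
  relative to \<open>z ^ 5\<close>, hence the extra factor \<open>z\<close>.\<close>

lemma cosh_quartic_limit:
  "((\<lambda>z::complex. (cosh z - 1 - z ^ 2 / 2) / z ^ 4) \<longlongrightarrow> 1 / 24) (at 0)"
proof -
  let ?r = "\<lambda>z::complex. (exp z - (\<Sum>i\<le>5. z ^ i / fact i)) / z ^ 5"
  let ?r' = "\<lambda>z::complex. (exp (- z) - (\<Sum>i\<le>5. (- z) ^ i / fact i)) / z ^ 5"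
  have "((\<lambda>z. 1 / 24 + (?r z + ?r' z) / 2 * z) \<longlongrightarrow> 1 / 24 + (0 + 0) / 2 * 0) (at 0)"
    by (intro tendsto_intros exp_remainder_limit exp_remainder_limit_minus) auto
  moreover have "\<forall>\<^sub>F z in at 0. 1 / 24 + (?r z + ?r' z) / 2 * z = (cosh z - 1 - z ^ 2 / 2) / z ^ 4"
    by (rule eventually_at_ball' [OF zero_less_one, THEN eventually_mono])
      (simp add: cosh_field_def atMost_nat_numeral fact_numeral field_simps eval_nat_numeral)
  ultimately show ?thesis
    using tendsto_cong by fastforce
qed

lemma sinh_quintic_limit:
  "((\<lambda>z::complex. (sinh z - z - z ^ 3 / 6) / z ^ 5) \<longlongrightarrow> 1 / 120) (at 0)"
proof -
  let ?r = "\<lambda>z::complex. (exp z - (\<Sum>i\<le>5. z ^ i / fact i)) / z ^ 5"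
  let ?r' = "\<lambda>z::complex. (exp (- z) - (\<Sum>i\<le>5. (- z) ^ i / fact i)) / z ^ 5"
  have "((\<lambda>z. 1 / 120 + (?r z - ?r' z) / 2) \<longlongrightarrow> 1 / 120 + (0 - 0) / 2) (at 0)"
    by (intro tendsto_intros exp_remainder_limit exp_remainder_limit_minus) auto
  moreover have "\<forall>\<^sub>F z in at 0. 1 / 120 + (?r z - ?r' z) / 2 = (sinh z - z - z ^ 3 / 6) / z ^ 5"
    by (rule eventually_at_ball' [OF zero_less_one, THEN eventually_mono])
      (simp add: sinh_field_def atMost_nat_numeral fact_numeral field_simps eval_nat_numeral)
  ultimately show ?thesis
    using tendsto_cong by fastforce
qed

text \<open>Antiderivatives of the last two basis functions, corrected by cubics and normalized so that
  they behave like \<open>x^4\<close> and \<open>x^5\<close> at the origin. The parameter \<open>\<kappa>\<close> is \<open>0\<close> for \<open>basis_hyp\<close> and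
  \<open>lam\<^sup>2\<close> for \<open>basis_hyp_corr\<close>; both generators are even in \<open>lam\<close>, hence real for real and for
  imaginary \<open>lam\<close>.\<close>

definition quartic_gen :: "complex \<Rightarrow> real \<Rightarrow> complex" where
  "quartic_gen lam x = 24 / lam ^ 4 * (cosh (lam * of_real x) - 1 - (lam * of_real x) ^ 2 / 2)"

definition quintic_gen :: "complex \<Rightarrow> complex \<Rightarrow> real \<Rightarrow> complex" where
  "quintic_gen lam \<kappa> x =
     120 / lam ^ 5 * (sinh (lam * of_real x) - lam * of_real x - (lam * of_real x) ^ 3 / 6)
     + \<kappa> * of_real x ^ 6 / 6"

lemma gen_zero [simp]: "quartic_gen lam 0 = 0" "quintic_gen lam \<kappa> 0 = 0"
  by (simp_all add: quartic_gen_def quintic_gen_def)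

lemma cnj_eq_or_eq_minus:
  assumes "Im lam = 0 \<or> Re lam = 0"
  obtains "cnj lam = lam" | "cnj lam = - lam"
  using assms by (auto simp: complex_eq_iff)

lemma cnj_cosh: "cnj (cosh z) = cosh (cnj z)" and cnj_sinh: "cnj (sinh z) = sinh (cnj z)"
  by (simp_all add: cosh_field_def sinh_field_def exp_cnj)

lemma quartic_gen_real:
  assumes "Im lam = 0 \<or> Re lam = 0"
  shows "of_real (Re (quartic_gen lam x)) = quartic_gen lam x"
proof -
  have "cnj (quartic_gen lam x) = quartic_gen lam x"
    by (rule cnj_eq_or_eq_minus [OF assms]) (simp_all add: quartic_gen_def cnj_cosh power_mult_distrib)
  then show ?thesis
    by (simp add: of_real_Re flip: Reals_cnj_iff)
qed

lemma quintic_gen_real: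
  assumes "Im lam = 0 \<or> Re lam = 0" "Im \<kappa> = 0"
  shows "of_real (Re (quintic_gen lam \<kappa> x)) = quintic_gen lam \<kappa> x"
proof -
  have "cnj \<kappa> = \<kappa>"
    using assms(2) by (simp add: complex_eq_iff)
  then have "cnj (quintic_gen lam \<kappa> x) = quintic_gen lam \<kappa> x"
    by (rule_tac cnj_eq_or_eq_minus [OF assms(1)])
      (simp_all add: quintic_gen_def cnj_sinh power_mult_distrib algebra_simps)
  then show ?thesis
    by (simp add: of_real_Re flip: Reals_cnj_iff)
qed

lemma filterlim_scaled_of_real_at_0:
  assumes "lam \<noteq> 0"
  shows "filterlim (\<lambda>x. lam * complex_of_real x) (at 0) (at 0)"
  using assms by (auto simp: filterlim_at eventually_at_filter intro!: tendsto_eq_intros)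

lemma quartic_gen_limit:
  assumes "lam \<noteq> 0"
  shows "((\<lambda>x. quartic_gen lam x / of_real x ^ 4) \<longlongrightarrow> 1) (at 0)"
proof -
  have "((\<lambda>x. 24 * ((cosh (lam * of_real x) - 1 - (lam * of_real x) ^ 2 / 2) / (lam * of_real x) ^ 4))
      \<longlongrightarrow> 24 * (1 / 24)) (at 0)"
    by (intro tendsto_mult_left filterlim_compose [OF cosh_quartic_limit filterlim_scaled_of_real_at_0 [OF assms]])
  then show ?thesis
    by (simp add: quartic_gen_def power_mult_distrib)
qed

lemma quintic_gen_limit:
  assumes "lam \<noteq> 0"
  shows "((\<lambda>x. quintic_gen lam \<kappa> x / of_real x ^ 5) \<longlongrightarrow> 1) (at 0)"
proof -
  \<comment> \<open>Dividing the \<open>\<kappa>\<close> term by the fifth power leaves a factor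
    \<open>x\<close>, so the correction does not disturb the leading term.\<close>
  have "((\<lambda>x. 120 * ((sinh (lam * of_real x) - lam * of_real x - (lam * of_real x) ^ 3 / 6) / (lam * of_real x) ^ 5)
      + \<kappa> * of_real x / 6) \<longlongrightarrow> 120 * (1 / 120) + \<kappa> * of_real 0 / 6) (at 0)"
    by (intro tendsto_intros filterlim_compose [OF sinh_quintic_limit filterlim_scaled_of_real_at_0 [OF assms]]) auto
  moreover have "120 * ((sinh (lam * of_real x) - lam * of_real x - (lam * of_real x) ^ 3 / 6) / (lam * of_real x) ^ 5)
      + \<kappa> * of_real x / 6 = quintic_gen lam \<kappa> x / of_real x ^ 5" for x
    by (cases "x = 0") (simp_all add: quintic_gen_def power_mult_distrib add_divide_distrib eval_nat_numeral)
  ultimately show ?thesis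
    by simp
qed

section \<open>Normal form of the interpolation space\<close>

lemma lin_spanI5: "f = (\<lambda>x. c0 * b 0 x + c1 * b 1 x + c2 * b 2 x + c3 * b 3 x + c4 * b 4 x) \<Longrightarrow> f \<in> lin_span 5 b"
  by (rule lin_spanI [where c = "\<lambda>i. [c0, c1, c2, c3, c4] ! i"]) (simp add: eval_nat_numeral)

lemma lin_spanI6: "f = (\<lambda>x. c0 * b 0 x + c1 * b 1 x + c2 * b 2 x + c3 * b 3 x + c4 * b 4 x + c5 * b 5 x)
  \<Longrightarrow> f \<in> lin_span 6 b"
  by (rule lin_spanI [where c = "\<lambda>i. [c0, c1, c2, c3, c4, c5] ! i"]) (simp add: eval_nat_numeral)

lemma less_5: "(i::nat) < 5 \<longleftrightarrow> i = 0 \<or> i = 1 \<or> i = 2 \<or> i = 3 \<or> i = 4"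
  and less_6: "(i::nat) < 6 \<longleftrightarrow> i = 0 \<or> i = 1 \<or> i = 2 \<or> i = 3 \<or> i = 4 \<or> i = 5"
  by auto

lemma has_vector_derivative_of_real_power:
  "((\<lambda>x. complex_of_real x ^ k) has_vector_derivative of_nat k * of_real x ^ (k - 1)) (at x)"
  by (rule has_vector_derivative_real_field) (auto intro!: derivative_eq_intros)

text \<open>Modulo quadratics, \<open>P'\<close> and \<open>Q'\<close> are nonzero multiples of
  \<open>b 3\<close> and \<open>b 4\<close>. Together with the derivatives of the cubic monomials
  they therefore span the same space as \<open>b\<close>.\<close>

lemma interp_system_span_cubics:
  assumes phi: "interp_system b \<phi>"
    and P: "\<And>x. (P has_vector_derivative P' x) (at x)"
    and Q: "\<And>x. (Q has_vector_derivative Q' x) (at x)"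
    and b012: "b 0 = (\<lambda>x. 1)" "b (Suc 0) = of_real" "b 2 = (\<lambda>x. of_real x ^ 2)"
    and P': "P' = (\<lambda>x. p0 + p1 * of_real x + p2 * of_real x ^ 2 + p3 * b 3 x)" "p3 \<noteq> 0"
    and Q': "Q' = (\<lambda>x. q0 + q1 * of_real x + q2 * of_real x ^ 2 + q4 * b 4 x)" "q4 \<noteq> 0"
  shows "lin_span 6 \<phi> = lin_span 6 (\<lambda>i x. [1, of_real x, of_real x ^ 2, of_real x ^ 3, P x, Q x] ! i)"
proof (rule interp_system_span_eq [OF phi])
  let ?E = "\<lambda>i x. [1, of_real x, of_real x ^ 2, of_real x ^ 3, P x, Q x] ! i"
  let ?E' = "\<lambda>i x. [0, 1, 2 * of_real x, 3 * of_real x ^ 2, P' x, Q' x] ! i"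
  show "(?E i has_vector_derivative ?E' i x) (at x)" if "i < 6" for i x
  proof -
    show ?thesis
      using that P [of x] Q [of x] has_vector_derivative_of_real_power [of 1 x]
        has_vector_derivative_of_real_power [of 2 x] has_vector_derivative_of_real_power [of 3 x]
      by (auto simp: less_6)
  qed
  show "(\<lambda>_. 1) \<in> lin_span 6 ?E"
    by (rule lin_spanI6 [of _ 1 _ 0 0 0 0 0]) simp
  show "lin_span 6 ?E' = lin_span 5 b"
  proof
    have "?E' 0 \<in> lin_span 5 b"
      by (rule lin_spanI5 [of _ 0 _ 0 0 0 0]) simp
    moreover have "?E' 1 \<in> lin_span 5 b"
      by (rule lin_spanI5 [of _ 1 _ 0 0 0 0]) (simp add: b012)
    moreover have "?E' 2 \<in> lin_span 5 b"
      by (rule lin_spanI5 [of _ 0 _ 2 0 0 0]) (simp add: b012)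
    moreover have "?E' 3 \<in> lin_span 5 b"
      by (rule lin_spanI5 [of _ 0 _ 0 3 0 0]) (simp add: b012)
    moreover have "?E' 4 \<in> lin_span 5 b"
      by (rule lin_spanI5 [of _ p0 _ p1 p2 p3 0]) (simp add: b012 P')
    moreover have "?E' 5 \<in> lin_span 5 b"
      by (rule lin_spanI5 [of _ q0 _ q1 q2 0 q4]) (simp add: b012 Q')
    ultimately show "lin_span 6 ?E' \<subseteq> lin_span 5 b"
      unfolding lin_span_subset_iff less_6 by blast
    have "b 0 \<in> lin_span 6 ?E'"
      by (rule lin_spanI6 [of _ 0 _ 1 0 0 0 0]) (simp add: b012)
    moreover have "b 1 \<in> lin_span 6 ?E'"
      by (rule lin_spanI6 [of _ 0 _ 0 "1/2" 0 0 0]) (simp add: b012 fun_eq_iff)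
    moreover have "b 2 \<in> lin_span 6 ?E'"
      by (rule lin_spanI6 [of _ 0 _ 0 0 "1/3" 0 0]) (simp add: b012)
    \<comment> \<open>The divisors 2 and 3 undo the factors in the derivatives of
      \<open>x ^ 2\<close> and \<open>x ^ 3\<close>.\<close>
    moreover have "b 3 \<in> lin_span 6 ?E'"
      by (rule lin_spanI6 [of _ 0 _ "- p0/p3" "- p1/(2*p3)" "- p2/(3*p3)" "1/p3" 0])
        (use P'(2) in \<open>simp add: P'(1) fun_eq_iff field_simps\<close>)
    moreover have "b 4 \<in> lin_span 6 ?E'"
      by (rule lin_spanI6 [of _ 0 _ "- q0/q4" "- q1/(2*q4)" "- q2/(3*q4)" 0 "1/q4"])
        (use Q'(2) in \<open>simp add: Q'(1) fun_eq_iff field_simps\<close>)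
    ultimately show "lin_span 5 b \<subseteq> lin_span 6 ?E'"
      unfolding lin_span_subset_iff less_5 by blast
  qed
qed

lemma has_vector_derivative_quartic_gen:
  assumes "lam \<noteq> 0"
  shows "(quartic_gen lam has_vector_derivative
    24 / lam ^ 3 * (sinh (lam * of_real x) - lam * of_real x)) (at x)"
proof -
  have "((\<lambda>z. 24 / lam ^ 4 * (cosh (lam * z) - 1 - (lam * z) ^ 2 / 2)) has_field_derivative
      24 / lam ^ 3 * (sinh (lam * z) - lam * z)) (at z)" for z
    using assms by (auto intro!: derivative_eq_intros simp: field_simps eval_nat_numeral)
  from has_vector_derivative_real_field [OF this] show ?thesis
    by (simp add: quartic_gen_def [abs_def])
qed

lemma has_vector_derivative_quintic_gen:
  assumes "lam \<noteq> 0"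
  shows "(quintic_gen lam \<kappa> has_vector_derivative
    120 / lam ^ 4 * (cosh (lam * of_real x) - 1 - (lam * of_real x) ^ 2 / 2) + \<kappa> * of_real x ^ 5) (at x)"
proof -
  have "((\<lambda>z. 120 / lam ^ 5 * (sinh (lam * z) - lam * z - (lam * z) ^ 3 / 6) + \<kappa> * z ^ 6 / 6)
      has_field_derivative
      120 / lam ^ 4 * (cosh (lam * z) - 1 - (lam * z) ^ 2 / 2) + \<kappa> * z ^ 5) (at z)" for z
    using assms by (auto intro!: derivative_eq_intros simp: field_simps eval_nat_numeral)
  from has_vector_derivative_real_field [OF this] show ?thesis
    by (simp add: quintic_gen_def [abs_def])
qed

text \<open>The Lagrange functions are real-valued, so all three spaces are brought to one real
  normal form; \<open>p\<close> and \<open>q\<close> are real parts of generators that take only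
  real values.\<close>

lemma interp_system_real_span:
  assumes lambda: "lam \<noteq> 0" "Im lam = 0 \<or> Re lam = 0"
    and space: "b \<in> {basis_poly, basis_hyp lam, basis_hyp_corr lam}"
    and phi: "interp_system b \<phi>"
  obtains p q :: "real \<Rightarrow> real" where
    "lin_span 6 \<phi> = lin_span 6 (\<lambda>i x. of_real ([1, x, x ^ 2, x ^ 3, p x, q x] ! i))"
    "p 0 = 0" "q 0 = 0" "((\<lambda>x. p x / x ^ 4) \<longlongrightarrow> 1) (at 0)" "((\<lambda>x. q x / x ^ 5) \<longlongrightarrow> 1) (at 0)"
proof -
  note result = that
  have thesis_if: thesis
    if span: "lin_span 6 \<phi> = lin_span 6 (\<lambda>i x. [1, of_real x, of_real x ^ 2, of_real x ^ 3, P x, Q x] ! i)"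
      and real: "\<And>x. of_real (Re (P x)) = P x" "\<And>x. of_real (Re (Q x)) = Q x"
      and zero: "P 0 = 0" "Q 0 = 0"
      and lim: "((\<lambda>x. P x / of_real x ^ 4) \<longlongrightarrow> 1) (at 0)" "((\<lambda>x. Q x / of_real x ^ 5) \<longlongrightarrow> 1) (at 0)"
    for P Q :: "real \<Rightarrow> complex"
  proof (rule result [of "\<lambda>x. Re (P x)" "\<lambda>x. Re (Q x)"])
    show "lin_span 6 \<phi> = lin_span 6 (\<lambda>i x. of_real ([1, x, x ^ 2, x ^ 3, Re (P x), Re (Q x)] ! i))"
      unfolding span by (rule lin_span_cong) (auto simp: less_6 real)
    have "Re (P x / of_real x ^ 4) = Re (P x) / x ^ 4" "Re (Q x / of_real x ^ 5) = Re (Q x) / x ^ 5" for x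
      by (simp_all flip: of_real_power)
    then show "((\<lambda>x. Re (P x) / x ^ 4) \<longlongrightarrow> 1) (at 0)" "((\<lambda>x. Re (Q x) / x ^ 5) \<longlongrightarrow> 1) (at 0)"
      using tendsto_Re [OF lim(1)] tendsto_Re [OF lim(2)] by simp_all
  qed (simp_all add: zero)
  \<comment> \<open>One argument serves both hyperbolic bases: the coefficient
    \<open>\<kappa> * lam ^ 4 / 120\<close> is zero for \<open>\<kappa> = 0\<close> and
    \<open>lam ^ 6 / fact 5\<close> for \<open>\<kappa> = lam ^ 2\<close>.\<close>
  have hyp: thesis
    if "b 0 = (\<lambda>x. 1)" "b (Suc 0) = of_real" "b 2 = (\<lambda>x. of_real x ^ 2)"
      "b 3 = (\<lambda>x. sinh (lam * of_real x))"
      "b 4 = (\<lambda>x. cosh (lam * of_real x) + \<kappa> * lam ^ 4 / 120 * of_real x ^ 5)" "Im \<kappa> = 0" for \<kappa>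
  proof (rule thesis_if)
    show "lin_span 6 \<phi> = lin_span 6
        (\<lambda>i x. [1, of_real x, of_real x ^ 2, of_real x ^ 3, quartic_gen lam x, quintic_gen lam \<kappa> x] ! i)"
      \<comment> \<open>The coefficients are read off from the derivatives of the generators; the
        quintic term of \<open>b 4\<close> matches the derivative \<open>\<kappa> * x ^ 5\<close> of
        the correction.\<close>
      by (rule interp_system_span_cubics [OF phi has_vector_derivative_quartic_gen [OF lambda(1)]
            has_vector_derivative_quintic_gen [OF lambda(1)] that(1,2,3),
            where ?p0.0 = 0 and ?p1.0 = "- 24 / lam ^ 2" and ?p2.0 = 0 and ?p3.0 = "24 / lam ^ 3"
              and ?q0.0 = "- 120 / lam ^ 4" and ?q1.0 = 0 and ?q2.0 = "- 60 / lam ^ 2" and ?q4.0 = "120 / lam ^ 4"])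
        (use lambda(1) that in \<open>simp_all add: fun_eq_iff field_simps eval_nat_numeral\<close>)
  qed (simp_all add: quartic_gen_real quintic_gen_real quartic_gen_limit quintic_gen_limit lambda that)
  consider "b = basis_poly" | "b = basis_hyp lam" | "b = basis_hyp_corr lam"
    using space by blast
  then show thesis
  proof cases
    case 1
    show ?thesis
    proof (rule thesis_if)
      show "lin_span 6 \<phi> = lin_span 6
          (\<lambda>i x. [1, of_real x, of_real x ^ 2, of_real x ^ 3, of_real x ^ 4, of_real x ^ 5] ! i)"
        by (rule interp_system_span_cubics [OF phi has_vector_derivative_of_real_power
              has_vector_derivative_of_real_power,
              where ?p0.0 = 0 and ?p1.0 = 0 and ?p2.0 = 0 and ?p3.0 = 4
              and ?q0.0 = 0 and ?q1.0 = 0 and ?q2.0 = 0 and ?q4.0 = 5])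
          (simp_all add: 1 basis_poly_def fun_eq_iff)
      show "((\<lambda>x. complex_of_real x ^ 4 / of_real x ^ 4) \<longlongrightarrow> 1) (at 0)"
        "((\<lambda>x. complex_of_real x ^ 5 / of_real x ^ 5) \<longlongrightarrow> 1) (at 0)"
        by (rule Lim_transform_eventually [OF tendsto_const], simp add: eventually_at_filter)+
    qed (simp_all flip: of_real_power)
  next
    case 2
    then show ?thesis
      by (intro hyp [of 0]) (simp_all add: basis_hyp_def fun_eq_iff)
  next
    case 3
    have "Im (lam ^ 2) = 0"
      using lambda(2) by (auto simp: power2_eq_square)
    with 3 show ?thesis
      by (intro hyp [of "lam ^ 2"])
        (simp_all add: basis_hyp_corr_def fun_eq_iff fact_numeral eval_nat_numeral)
  qed
qed

section \<open>Interpolation on six nodes\<close>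

text \<open>The cubic Lagrange polynomials on the nodes \<open>-1, 0, 1, 2\<close>, indexed so that \<open>n\<close> belongs to the
  node \<open>n - 3\<close> of \<open>-3, \<dots>, 2\<close>; the first two entries are placeholders.\<close>

definition cubic_cardinal :: "nat \<Rightarrow> real \<Rightarrow> real" where
  "cubic_cardinal n s =
    [0, 0, - (s * (s - 1) * (s - 2)) / 6, (s + 1) * (s - 1) * (s - 2) / 2,
     - ((s + 1) * s * (s - 2)) / 2, (s + 1) * s * (s - 1) / 6] ! n"

text \<open>The residual of cubic interpolation at the nodes -1, 0, 1, 2; it vanishes on
  cubics.\<close>

definition cubic_error :: "(real \<Rightarrow> real) \<Rightarrow> real \<Rightarrow> real" where
  "cubic_error F s = F s - (\<Sum>n=2..5. cubic_cardinal n s * F (real n - 3))"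

text \<open>Exactness on cubics expresses the weights at \<open>-1, 0, 1, 2\<close> through the weights \<open>u 0\<close>, \<open>u 1\<close> at
  \<open>-3, -2\<close>. Exactness on \<open>P\<close> and \<open>Q\<close> is then the system
  \<open>u 0 * cubic_error F (-3) + u 1 * cubic_error F (-2) = cubic_error F s\<close> for \<open>F = P, Q\<close>, with
  determinant \<open>error_det P Q\<close>, solved by Cramer's rule.\<close>

definition error_det :: "(real \<Rightarrow> real) \<Rightarrow> (real \<Rightarrow> real) \<Rightarrow> real" where
  "error_det P Q = cubic_error P (-3) * cubic_error Q (-2) - cubic_error P (-2) * cubic_error Q (-3)"

definition cramer_coeff :: "(real \<Rightarrow> real) \<Rightarrow> (real \<Rightarrow> real) \<Rightarrow> nat \<Rightarrow> real \<Rightarrow> real \<Rightarrow> real" where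
  "cramer_coeff P Q n e e' =
    (if n = 0 then e * cubic_error Q (-2) - e' * cubic_error P (-2)
     else e' * cubic_error P (-3) - e * cubic_error Q (-3)) / error_det P Q"

text \<open>The expression is linear in \<open>l\<close>, \<open>e\<close>, \<open>e'\<close>, which
  are kept as separate arguments: inserting values of the cubic cardinal and of the two cubic errors
  gives the Lagrange functions, inserting their slopes gives the derivatives.\<close>

definition cardinal_comb ::
  "(real \<Rightarrow> real) \<Rightarrow> (real \<Rightarrow> real) \<Rightarrow> nat \<Rightarrow> real \<Rightarrow> real \<Rightarrow> real \<Rightarrow> real" where
  "cardinal_comb P Q n l e e' =
    (if n \<le> 1 then cramer_coeff P Q n e e'
     else l - cramer_coeff P Q 0 e e' * cubic_cardinal n (-3)
            - cramer_coeff P Q 1 e e' * cubic_cardinal n (-2))"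

section \<open>Solving the interpolation conditions\<close>

lemma sum_0_5: fixes g :: "nat \<Rightarrow> real" shows "(\<Sum>n=0..5. g n) = g 0 + g 1 + g 2 + g 3 + g 4 + g 5"
  by (simp add: eval_nat_numeral)

lemma sum_2_5: fixes g :: "nat \<Rightarrow> real" shows "(\<Sum>n=2..5. g n) = g 2 + g 3 + g 4 + g 5"
  by (simp add: eval_nat_numeral)

lemma cubic_error_power:
  assumes "i < 4"
  shows "cubic_error (\<lambda>s. s ^ i) s = 0"
proof -
  consider "i = 0" | "i = 1" | "i = 2" | "i = 3"
    using assms by linarith
  then show ?thesis
    by cases (simp_all add: cubic_error_def sum_2_5 cubic_cardinal_def field_simps power2_eq_square power3_eq_cube)
qed

text \<open>Expanded so that linear arithmetic can treat \<open>s * s\<close> and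
  \<open>s * (s * s)\<close> as atoms.\<close>

lemma cubic_cardinal_expand:
  "cubic_cardinal 2 s = - (s * (s * s)) / 6 + s * s / 2 - s / 3"
  "cubic_cardinal 3 s = s * (s * s) / 2 - s * s - s / 2 + 1"
  "cubic_cardinal 4 s = - (s * (s * s)) / 2 + s * s / 2 + s"
  "cubic_cardinal 5 s = s * (s * s) / 6 - s / 6"
  by (simp_all add: cubic_cardinal_def field_simps)

lemma cubic_reproduction:
  assumes "\<And>i. i < 4 \<Longrightarrow> (\<Sum>n=0..5. u n * (real n - 3) ^ i) = s ^ i"
    and "n \<in> {2..5}"
  shows "u n = cubic_cardinal n s - u 0 * cubic_cardinal n (-3) - u 1 * cubic_cardinal n (-2)"
proof -
  have eqs: "u 0 + u 1 + u 2 + u 3 + u 4 + u 5 = 1"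
    "-3 * u 0 - 2 * u 1 - u 2 + u 4 + 2 * u 5 = s"
    "9 * u 0 + 4 * u 1 + u 2 + u 4 + 4 * u 5 = s * s"
    "-27 * u 0 - 8 * u 1 - u 2 + u 4 + 8 * u 5 = s * (s * s)"
    using assms(1) [of 0] assms(1) [of 1] assms(1) [of 2] assms(1) [of 3]
    by (simp_all add: sum_0_5 power2_eq_square power3_eq_cube)
  \<comment> \<open>The literals are the values of the cubic cardinals at -3 and -2, which keeps the
    goals linear in \<open>u\<close>.\<close>
  have "u 2 = cubic_cardinal 2 s - u 0 * 10 - u 1 * 4"
    "u 3 = cubic_cardinal 3 s - u 0 * (-20) - u 1 * (-6)"
    "u 4 = cubic_cardinal 4 s - u 0 * 15 - u 1 * 4"
    "u 5 = cubic_cardinal 5 s - u 0 * (-4) - u 1 * (-1)"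
    using eqs unfolding cubic_cardinal_expand by linarith+
  moreover have "n = 2 \<or> n = 3 \<or> n = 4 \<or> n = 5"
    using assms(2) by fastforce
  ultimately show ?thesis
    by (auto simp: cubic_cardinal_def)
qed

text \<open>What remains of exactness on \<open>F\<close> is one linear equation in
  \<open>u 0\<close> and \<open>u 1\<close>: the vanishing of the bracket.\<close>

lemma reproduction_defect:
  assumes "\<And>n. n \<in> {2..5} \<Longrightarrow>
    u n = cubic_cardinal n s - u 0 * cubic_cardinal n (-3) - u 1 * cubic_cardinal n (-2)"
  shows "(\<Sum>n=0..5. u n * F (real n - 3)) =
    F s - (cubic_error F s - u 0 * cubic_error F (-3) - u 1 * cubic_error F (-2))"
  by (simp add: sum_0_5 sum_2_5 cubic_error_def assms) (simp add: algebra_simps)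

text \<open>One direction gives uniqueness of the weights, the other existence; the definite
  description in \<open>lagrange_exp\<close> calls for both.\<close>

lemma interpolation_iff:
  assumes D: "error_det P Q \<noteq> 0"
  shows "(\<forall>i<4. (\<Sum>n=0..5. u n * (real n - 3) ^ i) = s ^ i) \<and>
      (\<Sum>n=0..5. u n * P (real n - 3)) = P s \<and> (\<Sum>n=0..5. u n * Q (real n - 3)) = Q s \<longleftrightarrow>
    (\<forall>n\<le>5. u n = cardinal_comb P Q n (cubic_cardinal n s) (cubic_error P s) (cubic_error Q s))"
    (is "?L \<longleftrightarrow> ?R")
proof
  assume L: ?L
  have u: "u n = cubic_cardinal n s - u 0 * cubic_cardinal n (-3) - u 1 * cubic_cardinal n (-2)"
    if "n \<in> {2..5}" for n
    using cubic_reproduction [of u s n] L that by blast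
  have e: "cubic_error P s = u 0 * cubic_error P (-3) + u 1 * cubic_error P (-2)"
    "cubic_error Q s = u 0 * cubic_error Q (-3) + u 1 * cubic_error Q (-2)"
    using L reproduction_defect [OF u, of P] reproduction_defect [OF u, of Q] by simp_all
  have "u 0 = cramer_coeff P Q 0 (cubic_error P s) (cubic_error Q s)"
    "u 1 = cramer_coeff P Q 1 (cubic_error P s) (cubic_error Q s)"
    using D unfolding cramer_coeff_def e by (simp_all add: eq_divide_eq) (simp_all add: error_det_def algebra_simps)
  with u show ?R
    by (auto simp: cardinal_comb_def le_Suc_eq)
next
  assume R: ?R
  have u01: "u 0 = cramer_coeff P Q 0 (cubic_error P s) (cubic_error Q s)"
    "u 1 = cramer_coeff P Q 1 (cubic_error P s) (cubic_error Q s)"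
    using R by (auto simp: cardinal_comb_def)
  have u: "u n = cubic_cardinal n s - u 0 * cubic_cardinal n (-3) - u 1 * cubic_cardinal n (-2)"
    if "n \<in> {2..5}" for n
    using R that by (simp add: u01 cardinal_comb_def)
  \<comment> \<open>Multiplying by the determinant clears the denominators of Cramer's rule; it is
    cancelled again at the end.\<close>
  have "cubic_error P s * error_det P Q = u 0 * error_det P Q * cubic_error P (-3) + u 1 * error_det P Q * cubic_error P (-2)"
    "cubic_error Q s * error_det P Q = u 0 * error_det P Q * cubic_error Q (-3) + u 1 * error_det P Q * cubic_error Q (-2)"
    unfolding u01 cramer_coeff_def using D by (simp_all) (simp_all add: error_det_def algebra_simps)
  then have "(cubic_error P s - u 0 * cubic_error P (-3) - u 1 * cubic_error P (-2)) * error_det P Q = 0"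
    "(cubic_error Q s - u 0 * cubic_error Q (-3) - u 1 * cubic_error Q (-2)) * error_det P Q = 0"
    by (simp_all add: algebra_simps)
  then show ?L
    using D reproduction_defect [OF u, of P] reproduction_defect [OF u, of Q]
      reproduction_defect [OF u, of "\<lambda>s. s ^ _"]
    by (simp add: cubic_error_power)
qed

section \<open>Limits of the optimal weights\<close>

text \<open>An affine change of variable carries the grid to the unit grid, and the factor
  \<open>h\<close> cancels the \<open>1 / h\<close> of the chain rule. The local coefficients are
  thus absolute constants.\<close>

lemma C_loc_scale:
  assumes "h > 0"
  shows "C_loc a h j k l = C_loc 0 1 0 k l"
proof -
  \<comment> \<open>The shift \<open>1/2\<close> is \<open>bdry 0 1 0\<close>, the image of the flux
    point.\<close>
  have eq: "lagrange_cubic a h j k n = (\<lambda>x. lagrange_cubic 0 1 0 k n ((x - bdry a h j) / h + 1/2))" for n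
  proof -
    have "(x - bdry a h (j - 3 + int k + int m)) /
        (bdry a h (j - 3 + int k + int n) - bdry a h (j - 3 + int k + int m)) =
        ((x - bdry a h j) / h + 1/2 - bdry 0 1 (0 - 3 + int k + int m)) /
        (bdry 0 1 (0 - 3 + int k + int n) - bdry 0 1 (0 - 3 + int k + int m))" for x m
    proof -
      have "x - bdry a h (j - 3 + int k + int m) =
          h * ((x - bdry a h j) / h + 1/2 - bdry 0 1 (0 - 3 + int k + int m))"
        "bdry a h (j - 3 + int k + int n) - bdry a h (j - 3 + int k + int m) =
          h * (bdry 0 1 (0 - 3 + int k + int n) - bdry 0 1 (0 - 3 + int k + int m))"
        using assms by (simp_all add: bdry_def field_simps)
      then show ?thesis
        using assms by simp
    qed
    then show ?thesis
      unfolding lagrange_cubic_def by presburger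
  qed
  have diff: "lagrange_cubic 0 1 0 k n field_differentiable at y" for n y
    unfolding lagrange_cubic_def divide_inverse field_differentiable_def
    by (rule exI, rule has_field_derivative_prod) (auto intro!: derivative_intros)
  have "h * deriv (lagrange_cubic a h j k n) (bdry a h j) = deriv (lagrange_cubic 0 1 0 k n) (bdry 0 1 0)" for n
  proof -
    have "(lagrange_cubic 0 1 0 k n has_real_derivative deriv (lagrange_cubic 0 1 0 k n) (1/2)) (at (1/2))"
      using diff by (simp add: field_differentiable_derivI)
    then have "(lagrange_cubic a h j k n has_real_derivative
        deriv (lagrange_cubic 0 1 0 k n) (1/2) * (1 / h)) (at (bdry a h j))"
      unfolding eq [of n] by (intro DERIV_chain2) (use assms in \<open>auto intro!: derivative_eq_intros\<close>)
    then show ?thesis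
      using assms by (simp add: DERIV_imp_deriv bdry_def)
  qed
  then show ?thesis
    by (simp add: C_loc_def sum_distrib_left)
qed

section \<open>Slopes at the flux point, which is 0 on the rescaled nodes, and their limits\<close>

definition cubic_cardinal_slope :: "nat \<Rightarrow> real" where
  "cubic_cardinal_slope n = [0, 0, - (1/3), - (1/2), 1, - (1/6)] ! n"

lemma DERIV_cubic_cardinal:
  assumes "n \<le> 5"
  shows "(cubic_cardinal n has_real_derivative cubic_cardinal_slope n) (at 0)"
proof -
  have "n = 0 \<or> n = 1 \<or> n = 2 \<or> n = 3 \<or> n = 4 \<or> n = 5"
    using assms by auto
  then show ?thesis
    by (auto simp: cubic_cardinal_def [abs_def] cubic_cardinal_slope_def intro!: derivative_eq_intros)
qed

definition cubic_error_slope :: "(real \<Rightarrow> real) \<Rightarrow> real" where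
  "cubic_error_slope F = - (\<Sum>n=2..5. cubic_cardinal_slope n * F (real n - 3))"

lemma DERIV_cubic_error:
  assumes "(F has_real_derivative 0) (at 0)"
  shows "(cubic_error F has_real_derivative cubic_error_slope F) (at 0)"
  unfolding cubic_error_def [abs_def] cubic_error_slope_def sum_2_5
  by (rule derivative_eq_intros DERIV_cubic_cardinal assms refl | simp)+

lemma DERIV_cardinal_comb:
  assumes "(l has_real_derivative l') (at s)" "(e has_real_derivative d) (at s)" "(e' has_real_derivative d') (at s)"
  shows "((\<lambda>s. cardinal_comb P Q n (l s) (e s) (e' s)) has_real_derivative cardinal_comb P Q n l' d d') (at s)"
proof -
  have "((\<lambda>s. cramer_coeff P Q m (e s) (e' s)) has_real_derivative cramer_coeff P Q m d d') (at s)" for m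
    unfolding cramer_coeff_def divide_inverse
    by (cases "m = 0") (auto intro!: derivative_eq_intros assms)
  then show ?thesis
    unfolding cardinal_comb_def
    by (cases "n \<le> 1") (auto intro!: derivative_eq_intros assms)
qed

lemma error_det_powers: "error_det (\<lambda>s. s ^ 4) (\<lambda>s. s ^ 5) = 2880"
  by (simp add: error_det_def cubic_error_def sum_2_5 cubic_cardinal_def)

text \<open>Vanishing to order at least 2 sends the difference quotient at the origin to 0.\<close>

lemma DERIV_zero_if_power_quotient_bounded:
  fixes p :: "real \<Rightarrow> real"
  assumes "p 0 = 0" "((\<lambda>x. p x / x ^ Suc (Suc k)) \<longlongrightarrow> c) (at 0)"
  shows "(p has_real_derivative 0) (at 0)"
proof -
  have "((\<lambda>x. p x / x ^ Suc (Suc k) * x ^ Suc k) \<longlongrightarrow> c * 0 ^ Suc k) (at 0)"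
    by (intro tendsto_intros assms(2))
  moreover have "p x / x ^ Suc (Suc k) * x ^ Suc k = (p (0 + x) - p 0) / x" for x
    using assms(1) by simp
  ultimately show ?thesis
    unfolding DERIV_def by simp
qed

lemma tendsto_scaled_power_quotient:
  fixes p :: "real \<Rightarrow> real"
  assumes "p 0 = 0" "((\<lambda>x. p x / x ^ k) \<longlongrightarrow> 1) (at 0)" "k > 0"
  shows "((\<lambda>h. p (s * h) / h ^ k) \<longlongrightarrow> s ^ k) (at_right 0)"
proof (cases "s = 0")
  case False
  have "filterlim (\<lambda>h. s * h) (at 0) (at_right 0)"
    using False by (auto simp: filterlim_at eventually_at_filter intro!: tendsto_eq_intros)
  from tendsto_mult_left [OF filterlim_compose [OF assms(2) this], of "s ^ k"] False show ?thesis
    by (simp add: power_mult_distrib)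
qed (use assms in \<open>simp add: zero_power\<close>)

text \<open>At each fixed \<open>x\<close> the conditions form a linear system in the six values
  \<open>L n x\<close>. Measuring \<open>x\<close> from the flux point in units of \<open>h\<close>
  moves the nodes to \<open>n - 3\<close>, and the powers of \<open>h\<close> cancel.\<close>

lemma lagrange_exp_eq:
  fixes p q :: "real \<Rightarrow> real"
  assumes span: "lin_span 6 \<phi> = lin_span 6 (\<lambda>i x. of_real ([1, x, x ^ 2, x ^ 3, p x, q x] ! i))"
    and h: "h > 0"
    and P: "P = (\<lambda>s. p (s * h) / h ^ 4)" and Q: "Q = (\<lambda>s. q (s * h) / h ^ 5)"
    and det: "error_det P Q \<noteq> 0"
  shows "lagrange_exp \<phi> a h j = restrict (\<lambda>n x. let s = (x - bdry a h j) / h in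
    cardinal_comb P Q n (cubic_cardinal n s) (cubic_error P s) (cubic_error Q s)) {0..5}"
    (is "_ = ?L")
proof -
  let ?E = "\<lambda>i x. [1, x, x ^ 2, x ^ 3, p x, q x] ! i"
  have less_4: "(i::nat) < 4 \<longleftrightarrow> i = 0 \<or> i = 1 \<or> i = 2 \<or> i = 3" for i
    by auto
  have node: "bdry a h (j - 3 + int n) - bdry a h j = (real n - 3) * h" for n
    by (simp add: bdry_def algebra_simps)
  have iff: "(\<forall>l\<le>5. \<forall>x. (\<Sum>n=0..5. of_real (L n x) * \<phi> l (bdry a h (j - 3 + int n) - bdry a h j))
                 = \<phi> l (x - bdry a h j)) \<longleftrightarrow> (\<forall>n\<le>5. L n = ?L n)" for L
  proof -
    have pointwise: "(\<forall>l<6. (\<Sum>n=0..5. of_real (L n x) * \<phi> l ((real n - 3) * h)) = \<phi> l (x - bdry a h j)) \<longleftrightarrow>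
        (\<forall>n\<le>5. L n x = ?L n x)" for x
    proof -
      define s where "s = (x - bdry a h j) / h"
      have x: "x - bdry a h j = s * h"
        using h by (simp add: s_def)
      have pow: "(\<Sum>n=0..5. L n x * ((real n - 3) * h) ^ i) = (s * h) ^ i \<longleftrightarrow>
          (\<Sum>n=0..5. L n x * (real n - 3) ^ i) = s ^ i" for i
      proof -
        have "(\<Sum>n=0..5. L n x * ((real n - 3) * h) ^ i) = (\<Sum>n=0..5. L n x * (real n - 3) ^ i) * h ^ i"
          by (simp add: power_mult_distrib sum_distrib_right mult.assoc)
        then show ?thesis
          using h by (simp add: power_mult_distrib)
      qed
      have scale: "(\<Sum>n=0..5. L n x * (F (real n - 3) / h ^ k)) = F s / h ^ k \<longleftrightarrow>
          (\<Sum>n=0..5. L n x * F (real n - 3)) = F s" for F k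
        using h by (simp flip: sum_divide_distrib)
      \<comment> \<open>Only the span matters, so \<open>\<phi>\<close> is exchanged for the real
        basis \<open>?E\<close>, after which the complex equations become real ones.\<close>
      have "(\<forall>l<6. (\<Sum>n=0..5. of_real (L n x) * \<phi> l ((real n - 3) * h)) = \<phi> l (x - bdry a h j)) \<longleftrightarrow>
          (\<forall>i<6. (\<Sum>n=0..5. of_real (L n x) * complex_of_real (?E i ((real n - 3) * h))) =
            of_real (?E i (x - bdry a h j)))"
        using reproduces_lin_span_iff [where b = \<phi> and m = 6 and N = "{0..5}" and u = "\<lambda>n. of_real (L n x)"
            and z = "\<lambda>n. (real n - 3) * h" and y = "x - bdry a h j"]
          reproduces_lin_span_iff [where b = "\<lambda>i x. of_real (?E i x)" and m = 6 and N = "{0..5}"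
            and u = "\<lambda>n. of_real (L n x)" and z = "\<lambda>n. (real n - 3) * h" and y = "x - bdry a h j"]
        unfolding span by argo
      also have "\<dots> \<longleftrightarrow> (\<forall>i<6. (\<Sum>n=0..5. L n x * ?E i ((real n - 3) * h)) = ?E i (s * h))"
        unfolding x by (simp flip: of_real_mult of_real_sum)
      also have "\<dots> \<longleftrightarrow> (\<forall>i<4. (\<Sum>n=0..5. L n x * ((real n - 3) * h) ^ i) = (s * h) ^ i) \<and>
          (\<Sum>n=0..5. L n x * p ((real n - 3) * h)) = p (s * h) \<and>
          (\<Sum>n=0..5. L n x * q ((real n - 3) * h)) = q (s * h)"
        unfolding less_6 less_4 by (simp add: imp_disjL all_conj_distrib)
      also have "\<dots> \<longleftrightarrow> (\<forall>i<4. (\<Sum>n=0..5. L n x * (real n - 3) ^ i) = s ^ i) \<and>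
          (\<Sum>n=0..5. L n x * P (real n - 3)) = P s \<and> (\<Sum>n=0..5. L n x * Q (real n - 3)) = Q s"
        unfolding pow P Q scale [of "\<lambda>s. p (s * h)"] scale [of "\<lambda>s. q (s * h)"] ..
      also have "\<dots> \<longleftrightarrow> (\<forall>n\<le>5. L n x = ?L n x)"
        unfolding interpolation_iff [OF det] by (simp add: s_def Let_def)
      finally show ?thesis .
    qed
    have "(\<forall>x. \<forall>l<6. (\<Sum>n=0..5. of_real (L n x) * \<phi> l ((real n - 3) * h)) = \<phi> l (x - bdry a h j)) \<longleftrightarrow>
        (\<forall>x. \<forall>n\<le>5. L n x = ?L n x)"
      by (rule iff_allI) (rule pointwise)
    moreover have le_5: "l \<le> 5 \<longleftrightarrow> l < 6" for l :: nat
      by auto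
    ultimately show ?thesis
      unfolding node fun_eq_iff le_5 by blast
  qed
  show ?thesis
    unfolding lagrange_exp_def iff
  proof (rule the_equality)
    show "?L \<in> extensional {0..5} \<and> (\<forall>n\<le>5. ?L n = ?L n)"
      by (intro conjI restrict_extensional allI impI refl)
  next
    fix L assume "L \<in> extensional {0..5} \<and> (\<forall>n\<le>5. L n = ?L n)"
    then show "L = ?L"
      by (rule_tac extensionalityI [of _ "{0..5}"]) auto
  qed
qed

text \<open>The closed form of the slope involves finitely many values of the rescaled generators,
  which tend to those of \<open>s ^ 4\<close> and \<open>s ^ 5\<close>. It contains neither
  \<open>a\<close> nor \<open>j\<close>, so the grid may move with \<open>h\<close>.\<close>

lemma lagrange_exp_slope_tendsto:
  fixes p q :: "real \<Rightarrow> real" and a :: "real \<Rightarrow> real" and j :: "real \<Rightarrow> int"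
  assumes span: "lin_span 6 \<phi> = lin_span 6 (\<lambda>i x. of_real ([1, x, x ^ 2, x ^ 3, p x, q x] ! i))"
    and p: "p 0 = 0" "((\<lambda>x. p x / x ^ 4) \<longlongrightarrow> 1) (at 0)"
    and q: "q 0 = 0" "((\<lambda>x. q x / x ^ 5) \<longlongrightarrow> 1) (at 0)"
    and n: "n \<le> 5"
  shows "\<exists>c. ((\<lambda>h. h * deriv (lagrange_exp \<phi> (a h) h (j h) n) (bdry (a h) h (j h))) \<longlongrightarrow> c) (at_right 0)"
proof -
  define P where "P h s = p (s * h) / h ^ 4" for h s
  define Q where "Q h s = q (s * h) / h ^ 5" for h s
  have P_lim: "((\<lambda>h. P h s) \<longlongrightarrow> s ^ 4) (at_right 0)" and Q_lim: "((\<lambda>h. Q h s) \<longlongrightarrow> s ^ 5) (at_right 0)" for s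
    unfolding P_def Q_def
    using tendsto_scaled_power_quotient [OF p] tendsto_scaled_power_quotient [OF q] by simp_all
  have err: "((\<lambda>h. cubic_error (P h) s) \<longlongrightarrow> cubic_error (\<lambda>s. s ^ 4) s) (at_right 0)"
    "((\<lambda>h. cubic_error (Q h) s) \<longlongrightarrow> cubic_error (\<lambda>s. s ^ 5) s) (at_right 0)"
    "((\<lambda>h. cubic_error_slope (P h)) \<longlongrightarrow> cubic_error_slope (\<lambda>s. s ^ 4)) (at_right 0)"
    "((\<lambda>h. cubic_error_slope (Q h)) \<longlongrightarrow> cubic_error_slope (\<lambda>s. s ^ 5)) (at_right 0)" for s
    unfolding cubic_error_def cubic_error_slope_def by (intro tendsto_intros P_lim Q_lim)+
  have det: "((\<lambda>h. error_det (P h) (Q h)) \<longlongrightarrow> 2880) (at_right 0)"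
    unfolding error_det_powers [symmetric] unfolding error_det_def by (intro tendsto_intros err)
  define w where "w h = cardinal_comb (P h) (Q h) n (cubic_cardinal_slope n)
    (cubic_error_slope (P h)) (cubic_error_slope (Q h))" for h
  define c where "c = cardinal_comb (\<lambda>s. s ^ 4) (\<lambda>s. s ^ 5) n (cubic_cardinal_slope n)
    (cubic_error_slope (\<lambda>s. s ^ 4)) (cubic_error_slope (\<lambda>s. s ^ 5))"
  have "((\<lambda>h. cramer_coeff (P h) (Q h) m (cubic_error_slope (P h)) (cubic_error_slope (Q h))) \<longlongrightarrow>
      cramer_coeff (\<lambda>s. s ^ 4) (\<lambda>s. s ^ 5) m (cubic_error_slope (\<lambda>s. s ^ 4)) (cubic_error_slope (\<lambda>s. s ^ 5)))
      (at_right 0)" for m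
    unfolding cramer_coeff_def error_det_powers
    by (cases "m = 0") (auto intro!: tendsto_intros err det)
  then have "(w \<longlongrightarrow> c) (at_right 0)"
    unfolding w_def c_def cardinal_comb_def by (cases "n \<le> 1") (auto intro!: tendsto_intros)
  moreover have "\<forall>\<^sub>F h in at_right 0. w h = h * deriv (lagrange_exp \<phi> (a h) h (j h) n) (bdry (a h) h (j h))"
  proof -
    \<comment> \<open>The nonzero limit 2880 makes the system solvable for small \<open>h\<close>,
      where the closed form of the Lagrange functions is valid.\<close>
    have "\<forall>\<^sub>F h in at_right 0. error_det (P h) (Q h) \<noteq> 0"
      using det by (rule tendsto_imp_eventually_ne) simp
    moreover have "\<forall>\<^sub>F h in at_right (0::real). h > 0"
      by (rule eventually_at_right_less)
    ultimately show ?thesis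
    proof eventually_elim
      case (elim h)
      have "(p has_real_derivative 0) (at 0)" "(q has_real_derivative 0) (at 0)"
        using DERIV_zero_if_power_quotient_bounded [of p 2] DERIV_zero_if_power_quotient_bounded [of q 3] p q
        by (simp_all add: eval_nat_numeral)
      moreover have PQ: "P h = (\<lambda>s. p (s * h) / h ^ 4)" "Q h = (\<lambda>s. q (s * h) / h ^ 5)"
        by (simp_all add: fun_eq_iff P_def Q_def)
      ultimately have "(P h has_real_derivative 0) (at 0)" "(Q h has_real_derivative 0) (at 0)"
        using elim(2)
        by (auto simp: PQ intro!: derivative_eq_intros DERIV_chain2 [where f = p] DERIV_chain2 [where f = q])
      then have slope: "((\<lambda>s. cardinal_comb (P h) (Q h) n (cubic_cardinal n s) (cubic_error (P h) s) (cubic_error (Q h) s))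
          has_real_derivative w h) (at ((bdry (a h) h (j h) - bdry (a h) h (j h)) / h))"
        unfolding w_def by (auto intro!: DERIV_cardinal_comb DERIV_cubic_cardinal DERIV_cubic_error n)
      have "((\<lambda>x. (x - bdry (a h) h (j h)) / h) has_real_derivative 1 / h) (at (bdry (a h) h (j h)))"
        using elim(2) by (auto intro!: derivative_eq_intros)
      from DERIV_chain2 [OF slope this]
      have "(lagrange_exp \<phi> (a h) h (j h) n has_real_derivative w h * (1 / h)) (at (bdry (a h) h (j h)))"
        using n by (simp add: lagrange_exp_eq [OF span elim(2) PQ elim(1)] Let_def)
      then show ?case
        using elim(2) by (simp add: DERIV_imp_deriv)
    qed
  qed
  ultimately show ?thesis
    using tendsto_cong by fastforce
qed

text \<open>The local coefficients being constants, the weights are fixed affine expressions in the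
  global coefficients, which converge.\<close>

lemma optimal_weight_tendsto:
  fixes p q :: "real \<Rightarrow> real" and a :: "real \<Rightarrow> real" and j :: "real \<Rightarrow> int"
  assumes "lin_span 6 \<phi> = lin_span 6 (\<lambda>i x. of_real ([1, x, x ^ 2, x ^ 3, p x, q x] ! i))"
    and "p 0 = 0" "((\<lambda>x. p x / x ^ 4) \<longlongrightarrow> 1) (at 0)"
    and "q 0 = 0" "((\<lambda>x. q x / x ^ 5) \<longlongrightarrow> 1) (at 0)"
    and "k \<in> {0, 1, 2}"
  shows "\<exists>c. ((\<lambda>h. optimal_weight \<phi> (a h) h (j h) k) \<longlongrightarrow> c) (at_right 0)"
proof -
  have "\<forall>n. \<exists>c. n \<le> 5 \<longrightarrow>
      ((\<lambda>h. h * deriv (lagrange_exp \<phi> (a h) h (j h) n) (bdry (a h) h (j h))) \<longlongrightarrow> c) (at_right 0)"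
    using lagrange_exp_slope_tendsto [OF assms(1-5)] by blast
  from choice [OF this] obtain c where "\<And>n. n \<le> 5 \<Longrightarrow>
      ((\<lambda>h. h * deriv (lagrange_exp \<phi> (a h) h (j h) n) (bdry (a h) h (j h))) \<longlongrightarrow> c n) (at_right 0)"
    by blast
  then have C: "((\<lambda>h. C_glob \<phi> (a h) h (j h) l) \<longlongrightarrow> (\<Sum>n=l+1..5. c n)) (at_right 0)" for l
    unfolding C_glob_def sum_distrib_left by (intro tendsto_sum) auto
  define d0 where "d0 h = C_glob \<phi> (a h) h (j h) 0 / C_loc 0 1 0 0 0" for h
  define d1 where "d1 h = (C_glob \<phi> (a h) h (j h) 1 - d0 h * C_loc 0 1 0 0 1) / C_loc 0 1 0 1 0" for h
  have "\<exists>r. (d0 \<longlongrightarrow> r) (at_right 0)"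
    unfolding d0_def [abs_def] divide_inverse by (rule exI, rule tendsto_mult_right, rule C)
  then obtain r0 where d0: "(d0 \<longlongrightarrow> r0) (at_right 0)"
    by blast
  have "\<exists>r. (d1 \<longlongrightarrow> r) (at_right 0)"
    unfolding d1_def [abs_def] divide_inverse
    by (rule exI, rule tendsto_mult_right, rule tendsto_diff, rule C, rule tendsto_mult_right, rule d0)
  then obtain r1 where d1: "(d1 \<longlongrightarrow> r1) (at_right 0)"
    by blast
  have "((\<lambda>h. [d0 h, d1 h, 1 - d0 h - d1 h] ! k) \<longlongrightarrow> [r0, r1, 1 - r0 - r1] ! k) (at_right 0)"
    using assms(6) d0 d1 by (auto intro!: tendsto_intros)
  moreover have "\<forall>\<^sub>F h in at_right 0.
      [d0 h, d1 h, 1 - d0 h - d1 h] ! k = optimal_weight \<phi> (a h) h (j h) k"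
    using eventually_at_right_less [of 0]
    by eventually_elim (simp add: optimal_weight_def Let_def d1_def d0_def C_loc_scale [of _ "a _"])
  ultimately show ?thesis
    using tendsto_cong by fastforce
qed

section \<open>Nonlinear weights\<close>

lemma Taylor4_bound:
  fixes f :: "real \<Rightarrow> real"
  assumes der: "\<And>n x. x \<in> {u..v} \<Longrightarrow> (deriv ^^ n) f field_differentiable (at x)"
    and bound: "\<And>x. x \<in> {u..v} \<Longrightarrow> \<bar>(deriv ^^ 4) f x\<bar> \<le> B"
    and c: "c \<in> {u..v}" and x: "x \<in> {u..v}"
  shows "\<bar>f x - (\<Sum>m<4. (deriv ^^ m) f c / fact m * (x - c) ^ m)\<bar> \<le> B / 24 * \<bar>x - c\<bar> ^ 4"
proof (cases "x = c")
  case True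
  then show ?thesis
    by (simp add: eval_nat_numeral)
next
  case False
  have "\<forall>m t. m < 4 \<and> u \<le> t \<and> t \<le> v \<longrightarrow> DERIV ((deriv ^^ m) f) t :> (deriv ^^ Suc m) f t"
    using der by (auto simp: field_differentiable_derivI)
  then obtain t where t: "if x < c then x < t \<and> t < c else c < t \<and> t < x"
    and eq: "f x = (\<Sum>m<4. (deriv ^^ m) f c / fact m * (x - c) ^ m) + (deriv ^^ 4) f t / fact 4 * (x - c) ^ 4"
    using Taylor [of 4 "\<lambda>m. (deriv ^^ m) f" f u v c x] c x False by auto
  have "t \<in> {u..v}"
    using t c x by (auto split: if_splits)
  then have "\<bar>(deriv ^^ 4) f t\<bar> \<le> B"
    by (rule bound)
  then have "\<bar>(deriv ^^ 4) f t\<bar> / 24 * \<bar>x - c\<bar> ^ 4 \<le> B / 24 * \<bar>x - c\<bar> ^ 4"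
    by (intro mult_right_mono divide_right_mono) auto
  then show ?thesis
    by (simp add: eq abs_mult power_abs fact_numeral)
qed

text \<open>The fourth difference annihilates the cubic Taylor polynomial at the center of cell
  \<open>j h\<close>, leaving only remainders of order \<open>h ^ 4\<close>.\<close>

lemma tau5_bigo:
  fixes a :: "real \<Rightarrow> real" and j :: "real \<Rightarrow> int"
  assumes smooth: "smooth_near f x0"
    and location: "((\<lambda>h. bdry (a h) h (j h)) \<longlongrightarrow> x0) (at_right 0)"
  shows "(\<lambda>h. tau5 (\<lambda>i. f (center (a h) h i)) (j h)) \<in> O[at_right 0](\<lambda>h. h ^ 4)"
proof -
  obtain S where S: "open S" "x0 \<in> S" "\<And>n x. x \<in> S \<Longrightarrow> (deriv ^^ n) f field_differentiable (at x)"
    using smooth by (auto simp: smooth_near_def)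
  then obtain e where e: "e > 0" "cball x0 e \<subseteq> S"
    using open_contains_cball by blast
  define I where "I = {x0 - e..x0 + e}"
  have "I \<subseteq> S"
    using e by (simp add: I_def cball_eq_atLeastAtMost)
  then have der: "(deriv ^^ n) f field_differentiable (at x)" if "x \<in> I" for n x
    using S that by blast
  have "continuous_on I ((deriv ^^ 4) f)"
    using der by (intro continuous_at_imp_continuous_on) (auto intro: field_differentiable_imp_continuous_at)
  then have "bounded ((deriv ^^ 4) f ` I)"
    unfolding I_def by (intro compact_imp_bounded compact_continuous_image) auto
  then obtain B where B: "\<And>x. x \<in> I \<Longrightarrow> \<bar>(deriv ^^ 4) f x\<bar> \<le> B"
    by (auto simp: bounded_iff)
  have small: "\<forall>\<^sub>F h in at_right 0. center (a h) h (j h + i) \<in> I" for i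
  proof -
    \<comment> \<open>Center \<open>j h + i\<close> lies \<open>i - 1/2\<close> cells from the flux
      point, so every stencil point tends to \<open>x0\<close>.\<close>
    have eq: "center (a h) h (j h + i) = bdry (a h) h (j h) + (of_int i - 1/2) * h" for h
      by (simp add: center_def bdry_def algebra_simps)
    have "((\<lambda>h. bdry (a h) h (j h) + (of_int i - 1/2) * h) \<longlongrightarrow> x0 + (of_int i - 1/2) * 0) (at_right 0)"
      by (intro tendsto_intros location)
    then have "\<forall>\<^sub>F h in at_right 0. dist (center (a h) h (j h + i)) x0 < e"
      unfolding eq using e(1) by (auto dest: tendstoD)
    then show ?thesis
      by eventually_elim (auto simp: I_def dist_real_def abs_less_iff)
  qed
  \<comment> \<open>The constant 40 = 16 + 4 + 0 + 4 + 16 weights the stencil coefficients 1, 4, 6,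
    4, 1 by the fourth powers of the offsets; 24 is the factorial in Taylor's remainder.\<close>
  have "\<forall>\<^sub>F h in at_right 0. norm (tau5 (\<lambda>i. f (center (a h) h i)) (j h)) \<le> (B / 24 * 40) * norm (h ^ 4)"
    using small [of "-2"] small [of "-1"] small [of 0] small [of 1] small [of 2]
  proof eventually_elim
    case (elim h)
    define c where "c = center (a h) h (j h)"
    have shift: "center (a h) h (j h + i) = c + of_int i * h" for i
      by (simp add: c_def center_def algebra_simps)
    define T where "T i = (\<Sum>m<4. (deriv ^^ m) f c / fact m * (of_int i * h) ^ m)" for i :: int
    define R where "R i = f (c + of_int i * h) - T i" for i :: int
    have R: "\<bar>R i\<bar> \<le> B / 24 * (of_int i ^ 4 * h ^ 4)" if "c + of_int i * h \<in> I" for i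
      using Taylor4_bound [of "x0 - e" "x0 + e" f B c "c + of_int i * h"] der B elim(3) that
      by (simp add: I_def R_def T_def c_def power_mult_distrib flip: power_abs)
    have bounds: "\<bar>R (-2)\<bar> \<le> B / 24 * (16 * h ^ 4)" "\<bar>R (-1)\<bar> \<le> B / 24 * h ^ 4" "\<bar>R 0\<bar> \<le> 0"
      "\<bar>R 1\<bar> \<le> B / 24 * h ^ 4" "\<bar>R 2\<bar> \<le> B / 24 * (16 * h ^ 4)"
      using R [of "-2"] R [of "-1"] R [of 0] R [of 1] R [of 2] elim unfolding shift by auto
    have "T (-2) - 4 * T (-1) + 6 * T 0 - 4 * T 1 + T 2 = 0"
      by (simp add: T_def eval_nat_numeral algebra_simps)
    moreover have "tau5 (\<lambda>i. f (center (a h) h i)) (j h) =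
        (T (-2) + R (-2)) - 4 * (T (-1) + R (-1)) + 6 * (T 0 + R 0) - 4 * (T 1 + R 1) + (T 2 + R 2)"
      using shift [of "-2"] shift [of "-1"] shift [of 0] shift [of 1] shift [of 2]
      by (simp add: tau5_def R_def)
    ultimately have "tau5 (\<lambda>i. f (center (a h) h i)) (j h) = R (-2) - 4 * R (-1) + 6 * R 0 - 4 * R 1 + R 2"
      by argo
    then have "\<bar>tau5 (\<lambda>i. f (center (a h) h i)) (j h)\<bar> \<le> B / 24 * (40 * h ^ 4)"
      using bounds by linarith
    then show ?case
      by (simp add: mult_ac)
  qed
  then show ?thesis
    by (rule bigoI)
qed

text \<open>The function \<open>\<beta>\<close> is arbitrary: the term
  \<open>h powr \<gamma>\<close> alone keeps the denominator above \<open>h ^ 4\<close>. Smoothness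
  indicators that vanish at critical points are thus covered.\<close>

lemma nonlinear_factor_bigo:
  fixes \<epsilon> \<tau> :: "real \<Rightarrow> real"
  assumes tau: "\<tau> \<in> O[at_right 0](\<lambda>h. h ^ 4)"
    and gamma: "\<gamma> \<le> 4"
  shows "(\<lambda>h. (\<tau> h)\<^sup>2 / ((\<beta> h)\<^sup>2 + h powr \<gamma>)) \<in> O[at_right 0](\<lambda>h. h ^ 4)"
proof -
  have "\<forall>\<^sub>F h in at_right 0. norm ((\<tau> h)\<^sup>2 / ((\<beta> h)\<^sup>2 + h powr \<gamma>)) \<le> norm ((\<tau> h)\<^sup>2 / h ^ 4)"
    using eventually_at_right_real [OF zero_less_one]
  proof eventually_elim
    case (elim h)
    then have "h ^ 4 = h powr 4"
      by simp
    \<comment> \<open>For a base between 0 and 1 the power decreases in the exponent.\<close>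
    also have "\<dots> \<le> h powr \<gamma>"
      using elim gamma by (intro powr_mono') auto
    also have "\<dots> \<le> (\<beta> h)\<^sup>2 + h powr \<gamma>"
      by simp
    finally show ?case
      using elim by (auto intro!: divide_left_mono mult_pos_pos add_nonneg_pos)
  qed
  then have "(\<lambda>h. (\<tau> h)\<^sup>2 / ((\<beta> h)\<^sup>2 + h powr \<gamma>)) \<in> O[at_right 0](\<lambda>h. (\<tau> h)\<^sup>2 / h ^ 4)"
    by (rule landau_o.big_mono)
  also have "(\<lambda>h. (\<tau> h)\<^sup>2 / h ^ 4) \<in> O[at_right 0](\<lambda>h. (h ^ 4)\<^sup>2 / h ^ 4)"
    by (intro landau_o.big.divide_right landau_o.big_power tau) (simp add: eventually_at_filter)
  also have "(\<lambda>h::real. (h ^ 4)\<^sup>2 / h ^ 4) = (\<lambda>h. h ^ 4)"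
    by (auto simp: fun_eq_iff power2_eq_square divide_simps)
  finally show ?thesis .
qed

lemma normalized_perturbation_bigo:
  fixes d q :: "nat \<Rightarrow> real \<Rightarrow> real"
  assumes d: "\<And>i. i \<le> 2 \<Longrightarrow> \<exists>c. (d i \<longlongrightarrow> c) (at_right 0)"
    and q: "\<And>i. i \<le> 2 \<Longrightarrow> q i \<in> O[at_right 0](\<lambda>h. h ^ 4)"
    and sum: "\<forall>\<^sub>F h in at_right 0. (\<Sum>i=0..2. d i h) = 1"
    and k: "k \<le> 2"
  shows "(\<lambda>h. d k h * (1 + q k h) / (\<Sum>i=0..2. d i h * (1 + q i h)) - d k h) \<in> O[at_right 0](\<lambda>h. h ^ 4)"
proof -
  define S where "S h = (\<Sum>i=0..2. d i h * q i h)" for h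
  have d_bigo: "d i \<in> O[at_right 0](\<lambda>_. 1)" if "i \<le> 2" for i
    using d [OF that] by (auto intro!: bigoI_tendsto)
  \<comment> \<open>Convergent weights are bounded, so each summand is of order
    \<open>h ^ 4\<close>; hence \<open>1 + S h\<close> tends to 1 and may be divided by.\<close>
  have S: "S \<in> O[at_right 0](\<lambda>h. h ^ 4)"
    unfolding S_def using landau_o.big.mult [OF d_bigo q] by (intro big_sum_in_bigo) auto
  also have "(\<lambda>h::real. h ^ 4) \<in> o[at_right 0](\<lambda>_. 1)"
    by (rule smalloI_tendsto) (auto intro!: tendsto_eq_intros)
  finally have "(S \<longlongrightarrow> 0) (at_right 0)"
    by (auto dest: smalloD_tendsto)
  then have lim: "((\<lambda>h. 1 + S h) \<longlongrightarrow> 1) (at_right 0)"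
    by (auto intro!: tendsto_eq_intros)
  obtain c where "(d k \<longlongrightarrow> c) (at_right 0)"
    using d [OF k] by blast
  from tendsto_divide [OF this lim] have "(\<lambda>h. d k h / (1 + S h)) \<in> O[at_right 0](\<lambda>_. 1)"
    by (auto intro!: bigoI_tendsto)
  from landau_o.big.mult [OF this sum_in_bigo(2) [OF q [OF k] S]]
  have "(\<lambda>h. d k h / (1 + S h) * (q k h - S h)) \<in> O[at_right 0](\<lambda>h. h ^ 4)"
    by simp
  moreover have "\<forall>\<^sub>F h in at_right 0. d k h / (1 + S h) * (q k h - S h) =
      d k h * (1 + q k h) / (\<Sum>i=0..2. d i h * (1 + q i h)) - d k h"
    using sum tendsto_imp_eventually_ne [OF lim, of 0, simplified]
  proof eventually_elim
    case (elim h)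
    have "(\<Sum>i=0..2. d i h * (1 + q i h)) = 1 + S h"
      using elim(1) by (simp add: S_def distrib_left sum.distrib)
    then show ?case
      using elim(2) by (simp add: field_simps)
  qed
  ultimately show ?thesis
    by (simp add: landau_o.big.in_cong)
qed

theorem proposition4p1:
  fixes f :: "real \<Rightarrow> real" and x0 :: real
    and a :: "real \<Rightarrow> real" and j :: "real \<Rightarrow> int"
    and \<theta> \<gamma> :: real and lam :: complex
    and b \<phi> :: "nat \<Rightarrow> real \<Rightarrow> complex" and k :: nat
  assumes theta: "0 < \<theta>" "\<theta> \<le> 1"
    and gamma: "0 < \<gamma>" "\<gamma> \<le> 4"
    and lambda: "lam \<noteq> 0" "Im lam = 0 \<or> Re lam = 0"
    and space: "b \<in> {basis_poly, basis_hyp lam, basis_hyp_corr lam}"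
    and phi: "interp_system b \<phi>"
    and smooth: "smooth_near f x0"
    and location: "((\<lambda>h. bdry (a h) h (j h)) \<longlongrightarrow> x0) (at_right 0)"
    and k: "k \<in> {0, 1, 2}"
  shows "(\<lambda>h. \<bar>omega (optimal_weight \<phi> (a h) h (j h)) \<theta> (h powr \<gamma>)
                  (\<lambda>i. f (center (a h) h i)) (j h) k
                - optimal_weight \<phi> (a h) h (j h) k\<bar>)
         \<in> O[at_right 0](\<lambda>h. h ^ 4)"
proof -
  define d where "d i h = optimal_weight \<phi> (a h) h (j h) i" for i h
  define v where "v h i = f (center (a h) h i)" for h i
  define q where "q i h = (tau5 (v h) (j h))\<^sup>2 / ((beta \<theta> (v h) (j h) i)\<^sup>2 + h powr \<gamma>)" for i h
  obtain p' q' :: "real \<Rightarrow> real" where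
    "lin_span 6 \<phi> = lin_span 6 (\<lambda>i x. of_real ([1, x, x ^ 2, x ^ 3, p' x, q' x] ! i))"
    "p' 0 = 0" "((\<lambda>x. p' x / x ^ 4) \<longlongrightarrow> 1) (at 0)" "q' 0 = 0" "((\<lambda>x. q' x / x ^ 5) \<longlongrightarrow> 1) (at 0)"
    by (rule interp_system_real_span [OF lambda space phi]) blast
  note d_lim = optimal_weight_tendsto [OF this, of _ a j]
  have "(\<lambda>h. d k h * (1 + q k h) / (\<Sum>i=0..2. d i h * (1 + q i h)) - d k h) \<in> O[at_right 0](\<lambda>h. h ^ 4)"
  proof (rule normalized_perturbation_bigo)
    show "\<exists>c. (d i \<longlongrightarrow> c) (at_right 0)" if "i \<le> 2" for i
      unfolding d_def [abs_def] by (rule d_lim) (use that in auto)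
    show "q i \<in> O[at_right 0](\<lambda>h. h ^ 4)" for i
      unfolding q_def [abs_def] v_def
      by (rule nonlinear_factor_bigo [OF tau5_bigo [OF smooth location] gamma(2)])
    \<comment> \<open>The third weight is defined as the complement of the first two.\<close>
    show "\<forall>\<^sub>F h in at_right 0. (\<Sum>i=0..2. d i h) = 1"
      by (simp add: d_def optimal_weight_def Let_def eval_nat_numeral)
    show "k \<le> 2"
      using k by auto
  qed
  then show ?thesis
    by (simp add: d_def q_def v_def [abs_def] omega_def alpha_def)
qed

end
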